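(* Let $0<a\le 1$ and $z\in\mathbb{C}$ with $0<|z|\le1$. For $\sigma>0$ and $t\in\mathbb{R}$ (whenever the expressions are defined) put $f_{\sigma,a,z}(t):=\Gamma(\sigma+{\rm i}t)\,\Phi(\sigma+{\rm i}t,a,z)$ and $F_{\sigma,a,z}(t):=f_{\sigma,a,z}(t)/f_{\sigma,a,z}(0)$. (1) Let $z=1$. Then $F_{\sigma,a,1}$ is the characteristic function of a probability measure on $\mathbb{R}$ for all $0<\sigma<1$ if and only if $a\ge 1/2$. Furthermore, in that case the associated probability measure is absolutely continuous with density $$P_{\sigma,a,1}(y)=\frac{e^{y\sigma}}{f_{\sigma,a,1}(0)}\left(\frac{\exp((1-a)e^{y})}{\exp(e^{y})-1}-\frac{1}{e^{y}}\right),\qquad y\in\mathbb{R}.$$ (2) Let $z\neq 1$. Then $F_{\sigma,a,z}$ is the characteristic function of a probability measure on $\mathbb{R}$ for all $\sigma>0$ if and only if $z\in[-1,1)$ (and $z\ne0$). In that case the associated probability measure is absolutely continuous with density $$P_{\sigma,a,z}(y)=\frac{e^{y\sigma}\exp((1-a)e^{y})}{f_{\sigma,a,z}(0)\,(\exp(e^{y})-z)},\qquad y\in\mathbb{R}.$$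
   Context: For $0<a\le1$, $s=\sigma+{\rm i}t$ and $z\in\mathbb{C}$ with $0<|z|\le1$, the Hurwitz–Lerch zeta function $\Phi(s,a,z)$ is defined for $\sigma>1$ by $\Phi(s,a,z)=\sum_{n=0}^\infty z^n(n+a)^{-s}$ and is extended by analytic continuation: for $z\ne1$ it is entire in $s$, and for $z=1$ it is the Hurwitz zeta function $\zeta(s,a)$, meromorphic in $\mathbb{C}$ with only a simple pole at $s=1$. The characteristic function of a probability measure $\mu$ on $\mathbb{R}$ is $\int_{\mathbb{R}} e^{{\rm i}ty}\mu(dy)$. *)

theory Defs
  imports "HOL-Probability.Probability" "HOL-Complex_Analysis.Complex_Analysis"
begin

text \<open>Domain of the analytic continuation of the Hurwitz-Lerch zeta function in s:
  the whole plane for z \<noteq> 1, the plane minus the pole s = 1 for z = 1.\<close>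
definition HLZ_dom :: "complex \<Rightarrow> complex set" where
  "HLZ_dom z = (if z = 1 then - {1} else UNIV)"

text \<open>Hurwitz-Lerch zeta function Phi(s,a,z): the (unique, by the identity theorem)
  holomorphic function on HLZ_dom z which for Re s > 1 equals the Dirichlet series
  sum_n z^n (n+a)^(-s).\<close>
definition HLPhi :: "complex \<Rightarrow> real \<Rightarrow> complex \<Rightarrow> complex" where
  "HLPhi s a z = (SOME g. g holomorphic_on HLZ_dom z \<and>
      (\<forall>w. 1 < Re w \<longrightarrow>
         (\<lambda>n. z ^ n * complex_of_real (real n + a) powr (- w)) sums g w)) s"

definition f_HL :: "real \<Rightarrow> real \<Rightarrow> complex \<Rightarrow> real \<Rightarrow> complex" where
  "f_HL \<sigma> a z t = Gamma (Complex \<sigma> t) * HLPhi (Complex \<sigma> t) a z"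

definition F_HL :: "real \<Rightarrow> real \<Rightarrow> complex \<Rightarrow> real \<Rightarrow> complex" where
  "F_HL \<sigma> a z t = f_HL \<sigma> a z t / f_HL \<sigma> a z 0"

definition P_HL1 :: "real \<Rightarrow> real \<Rightarrow> real \<Rightarrow> complex" where
  "P_HL1 \<sigma> a y = complex_of_real (exp (y * \<sigma>)) / f_HL \<sigma> a 1 0 *
     complex_of_real (exp ((1 - a) * exp y) / (exp (exp y) - 1) - 1 / exp y)"

definition P_HL :: "real \<Rightarrow> real \<Rightarrow> complex \<Rightarrow> real \<Rightarrow> complex" where
  "P_HL \<sigma> a z y = complex_of_real (exp (y * \<sigma>) * exp ((1 - a) * exp y)) /
     (f_HL \<sigma> a z 0 * (complex_of_real (exp (exp y)) - z))"

end

theory Submission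
  imports Defs
begin

text \<open>Substituting \<open>x = exp y\<close> in the Mellin integral of the Lerch function turns \<open>f_HL \<sigma> a z\<close> into the
  Fourier transform of \<open>exp (\<sigma> y)\<close> times the kernel \<open>exp ((1 - a) x) / (exp x - z)\<close>, from which
  \<open>1 / x\<close> is subtracted if \<open>z = 1\<close>. Such a Fourier transform is, up to normalisation, a characteristic
  function iff the kernel divided by its integral is real and nonnegative: for \<open>z \<noteq> 1\<close> this means that
  \<open>z\<close> is real, and for \<open>z = 1\<close> the kernel is negative if \<open>a \<ge> 1/2\<close> (because \<open>2 sinh (x/2) > x\<close>) but
  changes sign if \<open>a < 1/2\<close>, as it tends to \<open>1/2 - a\<close> at \<open>0\<close>.

  For the analytic continuation the Mellin integral is split at a small point \<open>d\<close>: the part beyond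
  \<open>d\<close> is entire, and the part below \<open>d\<close>, integrated termwise after a Taylor expansion of the kernel,
  is a series of simple fractions whose poles are cancelled by the zeros of \<open>1 / \<Gamma>\<close>.\<close>

section \<open>Exponential integrals on the line\<close>

text \<open>Euler's integral for Gamma after the substitution \<open>t = exp y\<close>. The
  parameter \<open>c\<close> enters through the translation of \<open>y\<close> by
  \<open>ln c\<close>, which produces the factor \<open>c powr (- s)\<close>.\<close>

lemma has_bochner_integral_Gamma_exp:
  fixes s :: complex and c :: real
  assumes s: "0 < Re s" and c: "0 < c"
  shows "has_bochner_integral lborel
    (\<lambda>y. exp (s * of_real y) * of_real (exp (- c * exp y))) (Gamma s * of_real c powr (- s))"
proof -
  let ?f = "\<lambda>t::real. complex_of_real t powr (s - 1) / of_real (exp t)"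
  have "?f absolutely_integrable_on {0<..}" "integral {0<..} ?f = Gamma s"
    using absolutely_integrable_Gamma_integral'[OF s] Gamma_integral_complex'[OF s]
    by (auto simp: integral_unique)
  moreover have "range (exp :: real \<Rightarrow> real) = {0<..}"
    by (auto simp: image_iff) (metis exp_ln)
  ultimately have 1: "(\<lambda>y. \<bar>exp y\<bar> *\<^sub>R ?f (exp y)) absolutely_integrable_on UNIV \<and>
      integral UNIV (\<lambda>y. \<bar>exp y\<bar> *\<^sub>R ?f (exp y)) = Gamma s"
    using has_absolute_integral_change_of_variables_real[of UNIV exp exp ?f "Gamma s"]
    by (auto intro: derivative_eq_intros simp: inj_on_def)
  have eq: "\<bar>exp y\<bar> *\<^sub>R ?f (exp y) = exp (s * of_real y) * of_real (exp (- exp y))" for y :: real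
  proof -
    have "complex_of_real (exp y) powr (s - 1) = exp ((s - 1) * of_real y)"
      by (simp add: powr_def Ln_of_real del: of_real_exp)
    then show ?thesis
      by (simp add: scaleR_conv_of_real exp_minus field_simps exp_of_real exp_diff)
  qed
  let ?g = "\<lambda>y::real. exp (s * of_real y) * complex_of_real (exp (- exp y))"
  have meas: "?g \<in> borel_measurable borel" by measurable
  have "?g absolutely_integrable_on UNIV" "integral UNIV ?g = Gamma s"
    using 1 unfolding eq by auto
  \<comment> \<open>Absolute integrability refers to Lebesgue measure, the completion of
    \<open>lborel\<close>; Borel measurability of \<open>?g\<close> brings it down to
    \<open>lborel\<close>.\<close>
  moreover from this have "integrable lborel ?g"
    using meas by (auto simp: set_integrable_def integrable_completion)
  ultimately have "has_bochner_integral lborel ?g (Gamma s)"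
    using integral_lborel[of ?g] unfolding has_bochner_integral_iff by simp
  then have "has_bochner_integral lborel (\<lambda>y. ?g (ln c + 1 * y)) (Gamma s /\<^sub>R \<bar>1\<bar>)"
    by (subst lborel_has_bochner_integral_real_affine_iff[symmetric]) auto
  then have "has_bochner_integral lborel (\<lambda>y. exp (- s * ln c) * ?g (ln c + y)) (exp (- s * ln c) * Gamma s)"
    by (intro has_bochner_integral_mult_right) auto
  moreover have "exp (- s * ln c) * ?g (ln c + y) = exp (s * of_real y) * of_real (exp (- c * exp y))" for y
    using c by (simp add: exp_add exp_minus algebra_simps exp_of_real[symmetric] del: of_real_exp)
  moreover have "exp (- s * ln c) * Gamma s = Gamma s * of_real c powr (- s)"
    using c by (simp add: powr_def Ln_of_real)
  ultimately show ?thesis by (simp only:)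
qed

lemma has_bochner_integral_exp_atLeast:
  fixes w :: complex and b :: real
  assumes w: "Re w < 0"
  shows "has_bochner_integral lborel (\<lambda>y. indicator {b..} y *\<^sub>R exp (w * of_real y)) (- exp (w * b) / w)"
proof -
  have "set_integrable lborel {b..} (\<lambda>y. exp (Re w * y))"
  proof -
    have "(\<lambda>y. exp (- (- Re w) * y)) integrable_on {b..}"
      using w by (intro integrable_on_exp_minus_to_infinity) auto
    then have "(\<lambda>y. exp (Re w * y)) absolutely_integrable_on {b..}"
      by (intro nonnegative_absolutely_integrable_1) auto
    then show ?thesis
      by (simp add: set_integrable_def integrable_completion)
  qed
  then have int: "set_integrable lborel {b..} (\<lambda>y. exp (w * of_real y))"
    unfolding set_integrable_def
    by (rule Bochner_Integration.integrable_bound) (auto simp: indicator_def)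
  have lim: "((\<lambda>y. exp (w * of_real y) / w) \<longlongrightarrow> 0) at_top"
  proof -
    have "((\<lambda>y. exp (r * y)) \<longlongrightarrow> 0) at_top" if "r < 0" for r :: real
      using that by real_asymp
    from tendsto_mult_left_zero[OF this[OF w], of "1 / norm w"]
    have "((\<lambda>y. exp (Re w * y) / norm w) \<longlongrightarrow> 0) at_top"
      by simp
    then have "((\<lambda>y. norm (exp (w * of_real y) / w)) \<longlongrightarrow> 0) at_top"
      by (simp add: norm_divide)
    then show ?thesis
      by (rule tendsto_norm_zero_cancel)
  qed
  have "(LBINT y=ereal b..\<infinity>. exp (w * of_real y)) = 0 - exp (w * b) / w"
  proof (rule interval_integral_FTC_integrable[where F = "\<lambda>y. exp (w * of_real y) / w"])
    show "set_integrable lborel (einterval (ereal b) \<infinity>) (\<lambda>y. exp (w * of_real y))"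
      by (rule set_integrable_subset[OF int]) auto
    show "((\<lambda>y. exp (w * of_real y) / w) has_vector_derivative exp (w * of_real x)) (at x)" for x
    proof -
      have "((\<lambda>u. exp (w * u) / w) has_field_derivative exp (w * x)) (at (of_real x))"
        using w by (auto intro!: derivative_eq_intros)
      from has_vector_derivative_real_field[OF this] show ?thesis .
    qed
    have "isCont (\<lambda>y. exp (w * complex_of_real y) / w) b"
      using w by (intro continuous_intros) auto
    then show "(((\<lambda>y. exp (w * of_real y) / w) \<circ> real_of_ereal) \<longlongrightarrow> exp (w * b) / w) (at_right (ereal b))"
      unfolding ereal_tendsto_simps isCont_def by (rule filterlim_mono) (auto simp: at_within_le_at)
    show "(((\<lambda>y. exp (w * of_real y) / w) \<circ> real_of_ereal) \<longlongrightarrow> 0) (at_left \<infinity>)"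
      unfolding ereal_tendsto_simps by (rule lim)
  qed auto
  moreover have "(LINT y:{b..}|lborel. exp (w * of_real y)) = (LINT y:{b<..}|lborel. exp (w * of_real y))"
  proof (rule set_integral_cong_set)
    show "AE y in lborel. y \<in> {b<..} \<longleftrightarrow> y \<in> {b..}"
      using AE_lborel_singleton[of b] by eventually_elim auto
  qed (auto simp: set_borel_measurable_def)
  ultimately have "(LINT y:{b..}|lborel. exp (w * of_real y)) = - exp (w * b) / w"
    by (simp add: interval_integral_to_infinity_eq)
  then show ?thesis
    using int by (simp add: has_bochner_integral_iff set_integrable_def set_lebesgue_integral_def)
qed

lemma has_bochner_integral_exp_lessThan:
  fixes w :: complex and b :: real
  assumes w: "0 < Re w"
  shows "has_bochner_integral lborel (\<lambda>y. indicator {..<b} y *\<^sub>R exp (w * of_real y)) (exp (w * b) / w)"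
proof -
  have "has_bochner_integral lborel (\<lambda>y. indicator {-b..} y *\<^sub>R exp (-w * of_real y)) (- exp (-w * of_real (-b)) / (-w))"
    using w by (intro has_bochner_integral_exp_atLeast) auto
  then have "has_bochner_integral lborel (\<lambda>y. indicator {-b..} (0 + (-1) * y) *\<^sub>R exp (-w * of_real (0 + (-1) * y)))
      ((- exp (-w * of_real (-b)) / (-w)) /\<^sub>R \<bar>-1\<bar>)"
    by (subst lborel_has_bochner_integral_real_affine_iff[symmetric]) auto
  then have "has_bochner_integral lborel (\<lambda>y. indicator {-b..} (- y) *\<^sub>R exp (w * of_real y)) (exp (w * b) / w)"
    by simp
  \<comment> \<open>Reflection produces the closed half-line up to \<open>b\<close>, which differs
    from \<open>{..<b}\<close> by a null set.\<close>
  then show ?thesis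
  proof (rule has_bochner_integral_cong_AE[THEN iffD1, rotated -1])
    show "AE y in lborel. indicator {-b..} (- y) *\<^sub>R exp (w * of_real y) = indicator {..<b} y *\<^sub>R exp (w * of_real y)"
      using AE_lborel_singleton[of b] by eventually_elim (auto simp: indicator_def)
  qed auto
qed

text \<open>Expanding \<open>exp (s * y)\<close> and integrating termwise gives a power series in
  \<open>s\<close> that converges everywhere. The exchange is dominated by
  \<open>exp (c * \<bar>y\<bar>) * norm (v y)\<close>, and \<open>c\<close> must be arbitrary
  because \<open>s\<close> is.\<close>

lemma holomorphic_integral_exp:
  fixes v :: "real \<Rightarrow> complex"
  assumes [measurable]: "v \<in> borel_measurable lborel"
    and int: "\<And>c. 0 < c \<Longrightarrow> integrable lborel (\<lambda>y. exp (c * \<bar>y\<bar>) * norm (v y))"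
  shows "(\<lambda>s. CLINT y|lborel. exp (s * of_real y) * v y) holomorphic_on UNIV"
proof -
  define a where "a = (\<lambda>n. CLINT y|lborel. of_real y ^ n * v y / fact n)"
  have "(\<lambda>n. a n * (s - 0) ^ n) sums (CLINT y|lborel. exp (s * of_real y) * v y)" for s
  proof -
    define f where "f = (\<lambda>n (y::real). (s * of_real y) ^ n /\<^sub>R fact n * v y)"
    \<comment> \<open>The summand 1 makes \<open>c\<close> positive even at \<open>s = 0\<close>, as
      \<open>int\<close> demands.\<close>
    define c where "c = norm s + 1"
    have "0 < c" by (simp add: c_def add_nonneg_pos)
    have [measurable]: "f n \<in> borel_measurable lborel" for n
      unfolding f_def by measurable
    have sum_norm: "(\<lambda>n. norm (f n y)) sums (exp (norm s * \<bar>y\<bar>) * norm (v y))" for y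
      using sums_mult2[OF exp_converges[of "norm s * \<bar>y\<bar>"], of "norm (v y)"]
      by (simp add: f_def norm_mult norm_power mult.assoc)
    have bound: "(\<Sum>n<N. norm (f n y)) \<le> exp (c * \<bar>y\<bar>) * norm (v y)" for N y
    proof -
      have "(\<Sum>n<N. norm (f n y)) \<le> (\<Sum>n. norm (f n y))"
        using sum_norm by (intro sum_le_suminf) (auto simp: sums_iff)
      also have "\<dots> = exp (norm s * \<bar>y\<bar>) * norm (v y)"
        using sum_norm by (simp add: sums_iff)
      also have "\<dots> \<le> exp (c * \<bar>y\<bar>) * norm (v y)"
        by (intro mult_right_mono) (auto simp: c_def algebra_simps)
      finally show ?thesis .
    qed
    have int_f: "integrable lborel (f n)" for n
    proof (rule Bochner_Integration.integrable_bound[OF int[OF \<open>0 < c\<close>]])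
      have "norm (f n y) \<le> exp (c * \<bar>y\<bar>) * norm (v y)" for y
        using member_le_sum[of n "{..<Suc n}" "\<lambda>n. norm (f n y)"] bound[where N = "Suc n" and y = y] by simp
      then show "AE y in lborel. norm (f n y) \<le> norm (exp (c * \<bar>y\<bar>) * norm (v y))"
        by auto
    qed measurable
    have "summable (\<lambda>n. LINT y|lborel. norm (f n y))"
    proof (rule summableI_nonneg_bounded)
      show "(\<Sum>n<N. LINT y|lborel. norm (f n y)) \<le> (LINT y|lborel. exp (c * \<bar>y\<bar>) * norm (v y))" for N
      proof -
        have "(\<Sum>n<N. LINT y|lborel. norm (f n y)) = (LINT y|lborel. (\<Sum>n<N. norm (f n y)))"
          using int_f by (subst Bochner_Integration.integral_sum) auto
        also have "\<dots> \<le> (LINT y|lborel. exp (c * \<bar>y\<bar>) * norm (v y))"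
          using int_f bound int[OF \<open>0 < c\<close>]
          by (intro integral_mono Bochner_Integration.integrable_sum integrable_norm) auto
        finally show ?thesis .
      qed
    qed auto
    then have "(\<lambda>n. CLINT y|lborel. f n y) sums (CLINT y|lborel. (\<Sum>n. f n y))"
      using int_f sum_norm by (intro sums_integral) (auto simp: sums_iff)
    moreover have "(\<Sum>n. f n y) = exp (s * of_real y) * v y" for y
      using sums_mult2[OF exp_converges[of "s * of_real y"], of "v y"]
      unfolding f_def by (simp add: sums_iff)
    moreover have "(CLINT y|lborel. f n y) = a n * (s - 0) ^ n" for n
      unfolding a_def f_def
      by (subst integral_mult_left_zero[symmetric])
         (auto intro!: Bochner_Integration.integral_cong
           simp: scaleR_conv_of_real power_mult_distrib field_simps)
    ultimately show ?thesis by simp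
  qed
  then have "(\<lambda>s. CLINT y|lborel. exp (s * of_real y) * v y) holomorphic_on ball 0 r" for r
    by (intro power_series_holomorphic[where a = a]) auto
  then have "(\<lambda>s. CLINT y|lborel. exp (s * of_real y) * v y) field_differentiable at s within ball 0 (norm s + 1)" for s
    by (auto simp: holomorphic_on_def add_nonneg_pos)
  moreover have "at s within ball 0 (norm s + 1) = at s" for s :: complex
    by (intro at_within_open) auto
  ultimately show ?thesis
    unfolding holomorphic_on_def by simp
qed

text \<open>This evaluates the part of the Mellin integral below \<open>d\<close>: the n-th Taylor
  term integrates to a simple fraction with its pole at \<open>- n\<close>, and
  \<open>exp y \<le> d\<close> bounds the norms by the given summable series.\<close>

lemma has_bochner_integral_exp_power_series:
  fixes c :: "nat \<Rightarrow> complex" and d :: real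
  assumes d: "0 < d" and c: "summable (\<lambda>n. norm (c n) * d ^ n)" and s: "0 < Re s"
  shows "has_bochner_integral lborel
      (\<lambda>y. indicator {..<ln d} y *\<^sub>R (exp (s * of_real y) * (\<Sum>n. c n * of_real (exp y) ^ n)))
      (\<Sum>n. c n * of_real d ^ n * exp (s * ln d) / (s + of_nat n))"
    and "summable (\<lambda>n. c n * of_real d ^ n * exp (s * ln d) / (s + of_nat n))"
proof -
  define f where "f = (\<lambda>n (y::real). c n * (indicator {..<ln d} y *\<^sub>R exp ((s + of_nat n) * of_real y)))"
  have edn: "exp (of_nat n * complex_of_real (ln d)) = of_real d ^ n" for n
    using d by (simp add: exp_of_nat_mult exp_of_real)
  have f: "has_bochner_integral lborel (f n) (c n * of_real d ^ n * exp (s * ln d) / (s + of_nat n))" for n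
  proof -
    have "exp ((s + of_nat n) * of_real (ln d)) = of_real d ^ n * exp (s * of_real (ln d))"
      by (simp only: distrib_right exp_add edn mult.commute[of "exp (s * of_real (ln d))"])
    then show ?thesis
      using has_bochner_integral_mult_right[of "c n", OF has_bochner_integral_exp_lessThan[of "s + of_nat n" "ln d"]] s
      by (simp only: f_def) (simp add: mult.assoc)
  qed
  then have int_f: "integrable lborel (f n)" for n
    by (auto simp: has_bochner_integral_iff)
  \<comment> \<open>Taking norms replaces \<open>s\<close> by \<open>Re s\<close>, so the integral
    of the norm is the same exponential integral at a real exponent.\<close>
  have norm_f: "norm (f n y) = norm (c n) * norm (indicator {..<ln d} y *\<^sub>R exp ((of_real (Re s) + of_nat n) * complex_of_real y))"
    for n y by (simp add: f_def norm_mult)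
  have int_norm: "(LINT y|lborel. norm (f n y)) = norm (c n) * (d ^ n * exp (Re s * ln d) / (Re s + real n))" for n
  proof -
    have "has_bochner_integral lborel
      (\<lambda>y. Re (indicator {..<ln d} y *\<^sub>R exp ((of_real (Re s) + of_nat n) * complex_of_real y)))
      (Re (exp ((of_real (Re s) + of_nat n) * of_real (ln d)) / (of_real (Re s) + of_nat n)))"
      using has_bochner_integral_exp_lessThan[of "of_real (Re s) + of_nat n" "ln d"] s
      by (intro has_bochner_integral_bounded_linear[OF bounded_linear_Re]) auto
    moreover have "Re (exp ((of_real (Re s) + of_nat n) * complex_of_real (ln d)) / (of_real (Re s) + of_nat n)) =
        d ^ n * exp (Re s * ln d) / (Re s + real n)"
    proof -
      have "exp ((of_real (Re s) + of_nat n) * complex_of_real (ln d)) = of_real (d ^ n * exp (Re s * ln d))"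
      proof -
        have "exp (of_real (Re s) * complex_of_real (ln d)) = of_real (exp (Re s * ln d))"
          by (simp flip: exp_of_real)
        then show ?thesis
          by (simp only: distrib_right exp_add edn) simp
      qed
      then show ?thesis
        by (metis Re_complex_of_real of_real_add of_real_divide of_real_of_nat_eq)
    qed
    moreover have "Re (indicator {..<ln d} y *\<^sub>R exp ((of_real (Re s) + of_nat n) * complex_of_real y)) =
      norm (indicator {..<ln d} y *\<^sub>R exp ((of_real (Re s) + of_nat n) * complex_of_real y))" for y
      by (simp add: indicator_def Re_exp)
    ultimately show ?thesis
      unfolding norm_f by (simp only: has_bochner_integral_iff integral_mult_right_zero)
  qed
  have summable_norm: "summable (\<lambda>n. norm (f n y))" for y
  proof (cases "y < ln d")
    case True
    have "exp y \<le> d" using True d by (metis exp_le_cancel_iff exp_ln less_imp_le)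
    have "norm (f n y) \<le> (norm (c n) * d ^ n) * exp (Re s * y)" for n
    proof -
      have "norm (f n y) = (norm (c n) * exp y ^ n) * exp (Re s * y)"
        using True by (simp add: f_def norm_mult distrib_right exp_add flip: exp_of_nat_mult)
      also have "\<dots> \<le> (norm (c n) * d ^ n) * exp (Re s * y)"
        using \<open>exp y \<le> d\<close> by (intro mult_right_mono mult_left_mono power_mono) auto
      finally show ?thesis .
    qed
    then show ?thesis
      using c by (intro summable_comparison_test[OF _ summable_mult2[OF c, of "exp (Re s * y)"]]) auto
  qed (simp add: f_def)
  have "summable (\<lambda>n. LINT y|lborel. norm (f n y))"
  proof (rule summable_comparison_test[OF _ summable_mult2[OF c, of "exp (Re s * ln d) / Re s"]], intro exI allI impI)
    fix n :: nat
    have "exp (Re s * ln d) / (Re s + real n) \<le> exp (Re s * ln d) / Re s"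
      using s by (intro divide_left_mono) auto
    then have "norm (c n) * d ^ n * (exp (Re s * ln d) / (Re s + real n)) \<le> norm (c n) * d ^ n * (exp (Re s * ln d) / Re s)"
      using d by (intro mult_left_mono) auto
    then show "norm (LINT y|lborel. norm (f n y)) \<le> norm (c n) * d ^ n * (exp (Re s * ln d) / Re s)"
      using s d unfolding int_norm by (simp add: abs_mult mult_ac)
  qed
  note sm = int_f AE_I2[OF summable_norm] this
  have "(\<Sum>n. f n y) = indicator {..<ln d} y *\<^sub>R (exp (s * of_real y) * (\<Sum>n. c n * of_real (exp y) ^ n))" for y
  proof (cases "y < ln d")
    case True
    have f_eq: "f n y = exp (s * of_real y) * (c n * of_real (exp y) ^ n)" for n
      using True by (simp add: f_def distrib_right exp_add flip: exp_of_nat_mult exp_of_real)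
    have "summable (\<lambda>n. exp (s * of_real y) * (c n * of_real (exp y) ^ n))"
      using summable_norm_cancel[OF summable_norm[of y]] unfolding f_eq .
    then have "summable (\<lambda>n. c n * of_real (exp y) ^ n)"
      by (simp add: summable_cmult_iff del: of_real_exp)
    then show ?thesis
      unfolding f_eq using True by (simp add: suminf_mult del: of_real_exp)
  qed (simp add: f_def)
  then show "has_bochner_integral lborel
      (\<lambda>y. indicator {..<ln d} y *\<^sub>R (exp (s * of_real y) * (\<Sum>n. c n * of_real (exp y) ^ n)))
      (\<Sum>n. c n * of_real d ^ n * exp (s * ln d) / (s + of_nat n))"
    using integrable_suminf[OF sm] sums_integral[OF sm] f
    by (simp add: has_bochner_integral_iff sums_iff)
  show "summable (\<lambda>n. c n * of_real d ^ n * exp (s * ln d) / (s + of_nat n))"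
    using sums_integral[OF sm] f by (simp add: has_bochner_integral_iff sums_iff)
qed

text \<open>Splits off the zero of \<open>rGamma\<close> at \<open>- n\<close> as an explicit linear
  factor, ready to cancel the pole of the n-th simple fraction.\<close>

lemma rGamma_pochhammer_Suc:
  "rGamma s = (s + of_nat n) * (pochhammer s n * rGamma (s + of_nat n + 1))"
  using pochhammer_rGamma[of s n] rGamma_plus1[of "s + of_nat n"] by (simp add: mult_ac)

text \<open>The n-th term is rGamma s / (s + n), with the removable singularity at -n filled in.\<close>
lemma holomorphic_rGamma_partial_fractions:
  fixes c :: "nat \<Rightarrow> complex"
  assumes c: "summable (\<lambda>n. norm (c n))"
  shows "(\<lambda>s. \<Sum>n. c n * (pochhammer s n * rGamma (s + of_nat n + 1))) holomorphic_on UNIV"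
proof (rule holomorphic_uniform_sequence)
  define T where "T = (\<lambda>n s::complex. pochhammer s n * rGamma (s + of_nat n + 1))"
  have hol: "T n holomorphic_on A" for n A
    unfolding T_def by (intro holomorphic_intros)
  show "(\<lambda>s. \<Sum>n<N. c n * (pochhammer s n * rGamma (s + of_nat n + 1))) holomorphic_on UNIV" for N
    by (intro holomorphic_on_sum holomorphic_on_mult[OF holomorphic_on_const] hol[unfolded T_def])
  show "\<exists>d>0. cball x d \<subseteq> UNIV \<and> uniform_limit (cball x d)
      (\<lambda>N s. \<Sum>n<N. c n * (pochhammer s n * rGamma (s + of_nat n + 1)))
      (\<lambda>s. \<Sum>n. c n * (pochhammer s n * rGamma (s + of_nat n + 1))) sequentially" for x :: complex
  proof (intro exI[of _ 1] conjI)
    have "compact ((\<lambda>s. norm (rGamma s)) ` cball x 1)"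
      by (intro compact_continuous_image continuous_intros compact_cball)
    then obtain K where K: "\<And>s. s \<in> cball x 1 \<Longrightarrow> norm (rGamma s) \<le> K"
      using compact_imp_bounded bounded_real by (metis (no_types, lifting) abs_norm_cancel imageI)
    \<comment> \<open>For such \<open>n\<close> the factor \<open>s + n\<close> has norm at least 1
      on the ball, so the n-th term is bounded by \<open>norm (rGamma s)\<close>. The finitely many
      earlier terms do not affect uniform convergence.\<close>
    have "eventually (\<lambda>n. real n > norm x + 2) sequentially"
      using eventually_gt_at_top filterlim_real_sequentially by (rule eventually_compose_filterlim)
    then have "\<forall>\<^sub>F n in sequentially. \<forall>s\<in>cball x 1. norm (c n * T n s) \<le> norm (c n) * K"
    proof eventually_elim
      case (elim n)
      show ?case
      proof
        fix s assume s: "s \<in> cball x 1"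
        have "norm s \<le> norm x + 1"
          using s norm_triangle_ineq2[of s x] by (auto simp: dist_norm norm_minus_commute)
        then have 1: "1 \<le> norm (s + of_nat n)"
          using elim norm_diff_ineq[of "of_nat n" s] by (simp add: add.commute)
        have "norm (T n s) * 1 \<le> norm (T n s) * norm (s + of_nat n)"
          using 1 by (intro mult_left_mono) auto
        also have "\<dots> = norm (rGamma s)"
          by (subst rGamma_pochhammer_Suc[of s n]) (simp add: T_def norm_mult mult_ac)
        also have "\<dots> \<le> K" using K s by auto
        finally show "norm (c n * T n s) \<le> norm (c n) * K"
          by (auto simp: norm_mult intro!: mult_left_mono)
      qed
    qed
    from Weierstrass_m_test_ev[OF this summable_mult2[OF c]]
    show "uniform_limit (cball x 1)
      (\<lambda>N s. \<Sum>n<N. c n * (pochhammer s n * rGamma (s + of_nat n + 1)))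
      (\<lambda>s. \<Sum>n. c n * (pochhammer s n * rGamma (s + of_nat n + 1))) sequentially"
      by (simp add: T_def)
  qed auto
qed auto

section \<open>Mellin transform of the kernel and analytic continuation\<close>

text \<open>With the term \<open>1/w\<close>, which is subtracted only for \<open>z = 1\<close>, the kernel is regular at the origin.\<close>
definition HL_kernel :: "real \<Rightarrow> complex \<Rightarrow> complex \<Rightarrow> complex" where
  "HL_kernel a z w = exp ((1 - of_real a) * w) / (exp w - z) - (if z = 1 then 1 / w else 0)"

text \<open>If \<open>z \<noteq> 1\<close>, the denominator does not vanish near 0 because
  \<open>exp 0 = 1\<close>. If \<open>z = 1\<close>, let \<open>E\<close> be
  \<open>(exp w - 1) / w\<close> with its singularity removed and
  \<open>k = exp ((1 - a) * w) / E w\<close>; as \<open>k 0 = 1\<close>, the kernel is the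
  difference quotient of \<open>k\<close> at 0.\<close>

lemma HL_kernel_holomorphic_extension:
  obtains Q r where "0 < r" "Q holomorphic_on ball 0 r"
    "\<And>w. w \<in> ball 0 r \<Longrightarrow> w \<noteq> 0 \<Longrightarrow> Q w = HL_kernel a z w"
proof (cases "z = 1")
  case False
  have "open {w. exp w \<noteq> z}"
    by (intro open_Collect_neq continuous_intros)
  then obtain r where r: "0 < r" "ball 0 r \<subseteq> {w. exp w \<noteq> z}"
    using False by (metis (mono_tags, lifting) exp_zero mem_Collect_eq openE)
  have "HL_kernel a z holomorphic_on ball 0 r"
    unfolding HL_kernel_def using False r(2)
    by (auto intro!: holomorphic_intros)
  with r(1) that show thesis by blast
next
  case True
  define E where "E = (\<lambda>w::complex. if w = 0 then deriv exp 0 else (exp w - exp 0) / (w - 0))"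
  have E: "E holomorphic_on UNIV"
    unfolding E_def by (intro pole_lemma_open holomorphic_intros) auto
  have E0: "E 0 = 1"
    by (simp add: E_def DERIV_imp_deriv[OF DERIV_exp])
  have "open {w. E w \<noteq> 0}"
    using E by (intro open_Collect_neq continuous_intros holomorphic_on_imp_continuous_on)
  then obtain r where r: "0 < r" "ball 0 r \<subseteq> {w. E w \<noteq> 0}"
    using E0 by (metis (mono_tags, lifting) mem_Collect_eq openE zero_neq_one)
  define k where "k = (\<lambda>w. exp ((1 - of_real a) * w) / E w)"
  have "k holomorphic_on ball 0 r"
    unfolding k_def using r(2) by (auto intro!: holomorphic_intros holomorphic_on_subset[OF E])
  then have "(\<lambda>w. if w = 0 then deriv k 0 else (k w - k 0) / (w - 0)) holomorphic_on ball 0 r"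
    by (intro pole_lemma_open) auto
  moreover have "(k w - k 0) / (w - 0) = HL_kernel a z w" if "w \<in> ball 0 r" "w \<noteq> 0" for w
  proof -
    have "E w \<noteq> 0" using that r by auto
    then show ?thesis
      using that True E0 by (auto simp: k_def HL_kernel_def E_def field_simps)
  qed
  ultimately show thesis
    using r(1) by (intro that[of r "\<lambda>w. if w = 0 then deriv k 0 else (k w - k 0) / (w - 0)"]) auto
qed

lemma HL_kernel_power_series:
  obtains c d where "0 < d" "summable (\<lambda>n. norm (c n) * d ^ n)"
    "\<And>x. 0 < x \<Longrightarrow> x < d \<Longrightarrow> (\<lambda>n. c n * of_real x ^ n) sums HL_kernel a z (of_real x)"
proof -
  obtain Q r where r: "0 < r" and Q: "Q holomorphic_on ball 0 r"
    and eq: "\<And>w. w \<in> ball 0 r \<Longrightarrow> w \<noteq> 0 \<Longrightarrow> Q w = HL_kernel a z w"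
    using HL_kernel_holomorphic_extension[where a = a and z = z] by blast
  define c where "c = (\<lambda>n. (deriv ^^ n) Q 0 / fact n)"
  have sums: "(\<lambda>n. c n * w ^ n) sums Q w" if "w \<in> ball 0 r" for w
    using holomorphic_power_series[OF Q that] by (simp add: c_def)
  \<comment> \<open>Convergence at a point strictly between \<open>r / 2\<close> and
    \<open>r\<close> yields absolute convergence at \<open>r / 2\<close>, which becomes
    \<open>d\<close>.\<close>
  have "summable (\<lambda>n. c n * of_real (3 / 4 * r) ^ n)"
    using sums[of "of_real (3 / 4 * r)"] r by (auto simp: sums_iff simp del: of_real_mult)
  from powser_insidea[OF this, of "of_real (r / 2)"]
  have "summable (\<lambda>n. norm (c n) * (r / 2) ^ n)"
    using r by (simp add: norm_mult norm_power)
  moreover have "(\<lambda>n. c n * of_real x ^ n) sums HL_kernel a z (of_real x)" if "0 < x" "x < r / 2" for x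
    using sums[of "of_real x"] eq[of "of_real x"] that r by auto
  ultimately show thesis
    using r by (intro that[of "r / 2" c]) auto
qed

section \<open>Decay of the kernel and the Dirichlet series\<close>

lemma exp_ne_of_norm_le_1:
  fixes z :: complex and x :: real
  assumes "norm z \<le> 1" "0 < x"
  shows "exp (of_real x) \<noteq> z"
proof
  assume "exp (of_real x) = z"
  then have "norm z = exp x" by (metis Re_complex_of_real norm_exp_eq_Re)
  with assms show False by (simp flip: not_less)
qed

text \<open>For \<open>x \<ge> d\<close> the denominator has norm at least \<open>exp x - 1\<close>,
  hence at least \<open>exp x * (1 - exp (- d))\<close>. With \<open>x = exp y\<close> the resulting
  decay is doubly exponential in \<open>y\<close>, so the part of the transform beyond
  \<open>d\<close> is entire.\<close>

lemma norm_exp_div_le: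
  fixes z :: complex and x d :: real
  assumes z: "norm z \<le> 1" and d: "0 < d" and x: "d \<le> x"
  shows "norm (exp ((1 - of_real a) * of_real x) / (exp (of_real x) - z)) \<le> exp (- a * x) / (1 - exp (- d))"
proof -
  have 1: "exp x * (1 - exp (- d)) \<le> norm (exp (of_real x) - z)"
  proof -
    have "exp x * exp (- d) = exp (x - d)" by (simp add: exp_diff exp_minus field_simps)
    also have "\<dots> \<ge> 1" using x by simp
    finally have "exp x * (1 - exp (- d)) \<le> exp x - norm z"
      using z by (simp add: right_diff_distrib)
    also have "\<dots> \<le> norm (exp (of_real x) - z)"
      using norm_triangle_ineq2[of "exp (of_real x)" z] by simp
    finally show ?thesis .
  qed
  have 2: "0 < 1 - exp (- d)" using d by simp
  have "norm (exp ((1 - of_real a) * of_real x) / (exp (of_real x) - z)) = exp ((1 - a) * x) / norm (exp (of_real x) - z)"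
    by (simp add: norm_divide)
  also have "\<dots> \<le> exp ((1 - a) * x) / (exp x * (1 - exp (- d)))"
  proof (intro divide_left_mono)
    have "0 < exp x * (1 - exp (- d))" using 2 by simp
    then show "0 < norm (exp (of_real x) - z) * (exp x * (1 - exp (- d)))"
      using 1 by (meson mult_pos_pos order.strict_trans2)
  qed (use 1 in auto)
  also have "\<dots> = exp (- a * x) / (1 - exp (- d))"
    using 2 by (simp add: left_diff_distrib exp_diff exp_minus field_simps)
  finally show ?thesis .
qed

lemma has_bochner_integral_Gamma_exp_real:
  fixes c r :: real
  assumes "0 < c" "0 < r"
  shows "has_bochner_integral lborel (\<lambda>y. exp (r * y) * exp (- c * exp y)) (Gamma r * c powr (- r))"
proof -
  have "has_bochner_integral lborel
    (\<lambda>y. Re (exp (of_real r * of_real y) * complex_of_real (exp (- c * exp y))))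
    (Re (Gamma (of_real r) * complex_of_real c powr (- of_real r)))"
    using has_bochner_integral_Gamma_exp[of "of_real r" c] assms
    by (intro has_bochner_integral_bounded_linear[OF bounded_linear_Re]) auto
  moreover have "Re (Gamma (of_real r) * complex_of_real c powr (- of_real r)) = Gamma r * c powr (- r)"
    using assms powr_of_real[of c "- r"]
    by (simp add: Gamma_complex_of_real del: of_real_mult flip: of_real_minus of_real_mult)
  moreover have "Re (exp (of_real r * of_real y) * complex_of_real (exp (- c * exp y))) =
      exp (r * y) * exp (- c * exp y)" for y
    by (simp add: Re_exp)
  ultimately show ?thesis by (simp only:)
qed

lemma summable_powr_add:
  fixes a r :: real
  assumes "0 < a" "1 < r"
  shows "summable (\<lambda>n. (real n + a) powr (- r))"
proof -
  have "summable (\<lambda>n. real n powr (- r))"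
    using assms by (subst summable_real_powr_iff) auto
  moreover have "norm ((real n + a) powr (- r)) \<le> real n powr (- r)" if "1 \<le> n" for n
    using that assms by (auto intro!: powr_mono2')
  then have "\<exists>N. \<forall>n\<ge>N. norm ((real n + a) powr (- r)) \<le> real n powr (- r)"
    by (intro exI[of _ 1] allI impI)
  ultimately show ?thesis
    by (rule summable_comparison_test[rotated])
qed

text \<open>The integrand is a geometric series with ratio \<open>z * exp (- exp y)\<close>, of norm
  below 1 even if \<open>norm z = 1\<close>. Each term is a Gamma integral, and
  \<open>1 < Re s\<close> makes the integrals of the norms summable.\<close>

lemma Gamma_Dirichlet_series:
  assumes a: "0 < a" and z: "norm z \<le> 1" and s: "1 < Re s"
  defines "k \<equiv> \<lambda>y. exp (s * of_real y) * (exp ((1 - of_real a) * exp (of_real y)) / (exp (exp (of_real y)) - z))"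
  shows "integrable lborel k"
    and "(\<lambda>n. Gamma s * (z ^ n * of_real (real n + a) powr (- s))) sums (CLINT y|lborel. k y)"
proof -
  define f where "f = (\<lambda>n (y::real). z ^ n * (exp (s * of_real y) * complex_of_real (exp (- (real n + a) * exp y))))"
  have f: "has_bochner_integral lborel (f n) (z ^ n * (Gamma s * of_real (real n + a) powr (- s)))" for n
    unfolding f_def using s a
    by (intro has_bochner_integral_mult_right has_bochner_integral_Gamma_exp) auto
  then have int_f: "integrable lborel (f n)" for n
    by (auto simp: has_bochner_integral_iff)
  have norm_f: "norm (f n y) = norm z ^ n * (exp (Re s * y) * exp (- (real n + a) * exp y))" for n y
    by (simp add: f_def norm_mult norm_power)
  have int_norm: "(LINT y|lborel. norm (f n y)) = norm z ^ n * (Gamma (Re s) * (real n + a) powr (- Re s))" for n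
    using has_bochner_integral_Gamma_exp_real[of "real n + a" "Re s"] a s
    unfolding norm_f by (simp add: has_bochner_integral_iff)
  have sums_f: "(\<lambda>n. f n y) sums k y" and sm_f: "summable (\<lambda>n. norm (f n y))" for y
  proof -
    define q where "q = z * exp (- exp (of_real y))"
    define C where "C = exp (s * of_real y) * exp (- of_real a * exp (of_real y))"
    have fq: "f n y = C * q ^ n" for n
      by (simp add: f_def C_def q_def power_mult_distrib exp_of_nat_mult[symmetric] exp_of_real[symmetric]
          distrib_right exp_add exp_minus exp_diff field_simps del: exp_of_real)
    have "norm q < 1"
    proof -
      have "norm q = norm z * exp (- exp y)"
        by (simp add: q_def norm_mult exp_of_real)
      also have "\<dots> \<le> exp (- exp y)" using z by (simp add: mult_left_le_one_le)
      also have "\<dots> < 1" by simp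
      finally show ?thesis .
    qed
    then show "summable (\<lambda>n. norm (f n y))"
      unfolding fq norm_mult norm_power by (intro summable_mult summable_geometric) auto
    have "C * (1 / (1 - q)) = k y"
    proof -
      have "1 - q = exp (- exp (of_real y)) * (exp (exp (of_real y)) - z)"
        by (simp add: q_def right_diff_distrib exp_minus)
      moreover have "exp (- of_real a * exp (of_real y)) = exp ((1 - of_real a) * exp (of_real y)) * exp (- exp (complex_of_real y))"
        by (simp add: exp_add[symmetric] algebra_simps)
      ultimately show ?thesis
        by (simp add: C_def k_def)
    qed
    with sums_mult[OF geometric_sums[OF \<open>norm q < 1\<close>], of C]
    show "(\<lambda>n. f n y) sums k y" by (simp add: fq)
  qed
  have "summable (\<lambda>n. LINT y|lborel. norm (f n y))"
  proof (rule summable_comparison_test[OF _ summable_mult[OF summable_powr_add[OF a s], of "Gamma (Re s)"]], intro exI allI impI)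
    fix n :: nat
    have "norm z ^ n \<le> 1" using z by (simp add: power_le_one)
    moreover have "0 \<le> Gamma (Re s)" using s by (simp add: Gamma_real_pos less_imp_le)
    ultimately show "norm (LINT y|lborel. norm (f n y)) \<le> Gamma (Re s) * (real n + a) powr (- Re s)"
      unfolding int_norm by (simp add: abs_mult mult_left_le_one_le)
  qed
  note sm = int_f AE_I2[OF sm_f] this
  show "integrable lborel k"
    using integrable_suminf[OF sm] sums_f by (simp add: sums_iff)
  show "(\<lambda>n. Gamma s * (z ^ n * of_real (real n + a) powr (- s))) sums (CLINT y|lborel. k y)"
    using sums_integral[OF sm] sums_f f by (simp add: sums_iff has_bochner_integral_iff mult_ac)
qed

text \<open>One function with the two defining properties shows that the choice in
  \<open>HLPhi\<close> is meaningful; the identity theorem on the connected set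
  \<open>HLZ_dom z\<close>, started from the half-plane \<open>1 < Re w\<close>, shows that the
  choice agrees with it.\<close>

lemma HLPhi_eqI:
  assumes g: "g holomorphic_on HLZ_dom z"
    and sums: "\<And>w. 1 < Re w \<Longrightarrow> (\<lambda>n. z ^ n * complex_of_real (real n + a) powr (- w)) sums g w"
    and s: "s \<in> HLZ_dom z"
  shows "HLPhi s a z = g s"
proof -
  define P where "P = (\<lambda>g. g holomorphic_on HLZ_dom z \<and>
      (\<forall>w. 1 < Re w \<longrightarrow> (\<lambda>n. z ^ n * complex_of_real (real n + a) powr (- w)) sums g w))"
  have "P g" using g sums by (auto simp: P_def)
  then have P: "P (SOME g. P g)" by (rule someI[of P])
  have "(SOME g. P g) s = g s"
  proof (rule analytic_continuation_open[where s = "{w. 1 < Re w}" and s' = "HLZ_dom z" and f = "SOME g. P g" and g = g and z = s])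
    show "open (HLZ_dom z)" "connected (HLZ_dom z)"
      by (auto simp: HLZ_dom_def connected_punctured_universe)
    show "open {w. 1 < Re w}" by (rule open_halfspace_Re_gt)
    have "2 \<in> {w. 1 < Re w}" by simp
    then show "{w. 1 < Re w} \<noteq> {}" by blast
    show "{w. 1 < Re w} \<subseteq> HLZ_dom z" by (auto simp: HLZ_dom_def)
    show "(SOME g. P g) w = g w" if "w \<in> {w. 1 < Re w}" for w
      using P sums[of w] that sums_unique2 by (auto simp: P_def)
  qed (use g P s in \<open>auto simp: P_def\<close>)
  then show ?thesis by (simp add: HLPhi_def P_def)
qed

lemma Gamma_mult_rGamma:
  fixes w :: complex
  assumes "0 < Re w"
  shows "Gamma w * rGamma w = 1"
proof -
  have "Gamma w \<noteq> 0"
    using assms by (auto simp: Gamma_eq_zero_iff elim!: nonpos_Ints_cases)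
  then show ?thesis by (simp add: rGamma_inverse_Gamma)
qed

text \<open>An explicit continuation \<open>g\<close> is matched with the Dirichlet series on
  \<open>1 < Re w\<close> and then read at \<open>s\<close>. For \<open>z = 1\<close> the passage
  rests on one expression, \<open>pole\<close>, having two integral representations:
  \<open>exp ((w - 1) * y)\<close> over \<open>y < b\<close> if \<open>1 < Re w\<close>, and its
  negative over \<open>y \<ge> b\<close> if \<open>Re w < 1\<close>.\<close>

lemma Gamma_HLPhi_has_bochner_integral:
  assumes a: "0 < a" and z: "norm z \<le> 1" and s: "0 < Re s" and z1: "z = 1 \<Longrightarrow> Re s < 1"
  shows "has_bochner_integral lborel
    (\<lambda>y. exp (s * of_real y) * HL_kernel a z (of_real (exp y))) (Gamma s * HLPhi s a z)"
proof -
  obtain d c where d: "0 < d" and c: "summable (\<lambda>n. norm (c n) * d ^ n)"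
    and power_series: "\<And>x. 0 < x \<Longrightarrow> x < d \<Longrightarrow> (\<lambda>n. c n * of_real x ^ n) sums HL_kernel a z (of_real x)"
    by (rule HL_kernel_power_series[where a = a and z = z]) (rule that, assumption+)
  define b where "b = ln d"
  define e :: complex where "e = (if z = 1 then 1 else 0)"
  define h where "h = (\<lambda>y::real. exp ((1 - of_real a) * exp (of_real y)) / (exp (exp (of_real y)) - z))"
  have kernel: "HL_kernel a z (of_real (exp y)) = h y - e * exp (- of_real y)" for y
    by (simp add: HL_kernel_def h_def e_def exp_minus exp_of_real[symmetric] divide_inverse)
  define v where "v = (\<lambda>y. indicator {b..} y *\<^sub>R h y)"
  define R where "R = (\<lambda>s. CLINT y|lborel. exp (s * of_real y) * v y)"
  define pole where "pole = (\<lambda>s. e * exp ((s - 1) * of_real b) / (s - 1))"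
  define L where "L = (\<lambda>s. \<Sum>n. c n * of_real d ^ n * exp (s * of_real b) / (s + of_nat n))"
  define S where "S = (\<lambda>s. \<Sum>n. c n * of_real d ^ n * (pochhammer s n * rGamma (s + of_nat n + 1)))"
  \<comment> \<open>For \<open>Re s > 0\<close> this is
    \<open>rGamma s * (R s + pole s + L s)\<close>. Writing the last part through \<open>S\<close>
    keeps it holomorphic at the nonpositive integers, so \<open>g\<close> lives on all of
    \<open>HLZ_dom z\<close>.\<close>
  define g where "g = (\<lambda>s. rGamma s * (R s + pole s) + exp (s * of_real b) * S s)"

  have [measurable]: "h \<in> borel_measurable lborel"
    unfolding h_def by measurable
  have [measurable]: "v \<in> borel_measurable lborel"
    unfolding v_def by measurable
  have int_v: "integrable lborel (\<lambda>y. exp (r * \<bar>y\<bar>) * norm (v y))" if r: "0 < r" for r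
  proof -
    \<comment> \<open>The numerator comes from
      \<open>\<bar>y\<bar> \<le> 2 * \<bar>b\<bar> + y\<close> for \<open>y \<ge> b\<close>, the
      denominator from the decay bound on the kernel.\<close>
    define C where "C = exp (2 * r * \<bar>b\<bar>) / (1 - exp (- d))"
    have "0 \<le> C" using d by (simp add: C_def)
    have bound: "exp (r * \<bar>y\<bar>) * norm (v y) \<le> C * (exp (r * y) * exp (- a * exp y))" for y
    proof (cases "b \<le> y")
      case True
      then have dy: "d \<le> exp y" using d by (metis b_def exp_le_cancel_iff exp_ln)
      have "norm (h y) \<le> exp (- a * exp y) / (1 - exp (- d))"
        using norm_exp_div_le[OF z d dy, of a] by (simp add: h_def exp_of_real)
      moreover have "exp (r * \<bar>y\<bar>) \<le> exp (2 * r * \<bar>b\<bar>) * exp (r * y)"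
      proof -
        have "\<bar>y\<bar> \<le> 2 * \<bar>b\<bar> + y" using True by linarith
        then have "r * \<bar>y\<bar> \<le> r * (2 * \<bar>b\<bar> + y)"
          using r by (intro mult_left_mono) auto
        then show ?thesis
          by (simp add: algebra_simps flip: exp_add)
      qed
      ultimately have "exp (r * \<bar>y\<bar>) * norm (h y) \<le>
          (exp (2 * r * \<bar>b\<bar>) * exp (r * y)) * (exp (- a * exp y) / (1 - exp (- d)))"
        by (intro mult_mono) auto
      then show ?thesis
        using True by (simp add: v_def C_def)
    qed (use \<open>0 \<le> C\<close> in \<open>simp add: v_def\<close>)
    show ?thesis
    proof (rule Bochner_Integration.integrable_bound)
      show "integrable lborel (\<lambda>y. C * (exp (r * y) * exp (- a * exp y)))"
        using has_bochner_integral_Gamma_exp_real[OF a r]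
        by (intro integrable_mult_right) (auto simp: has_bochner_integral_iff)
      have "norm (exp (r * \<bar>y\<bar>) * norm (v y)) \<le> norm (C * (exp (r * y) * exp (- a * exp y)))" for y
        using bound[of y] \<open>0 \<le> C\<close> by simp
      then show "AE y in lborel. norm (exp (r * \<bar>y\<bar>) * norm (v y)) \<le> norm (C * (exp (r * y) * exp (- a * exp y)))"
        by blast
    qed measurable
  qed
  have R_hol: "R holomorphic_on UNIV"
    unfolding R_def using int_v by (intro holomorphic_integral_exp) auto
  have R_int: "has_bochner_integral lborel (\<lambda>y. exp (w * of_real y) * v y) (R w)" for w
  proof -
    have pos: "0 < norm w + 1" by (simp add: add_nonneg_pos)
    have "integrable lborel (\<lambda>y. exp (w * of_real y) * v y)"
    proof (rule Bochner_Integration.integrable_bound[OF int_v[OF pos]])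
      have "exp (Re w * y) \<le> exp ((norm w + 1) * \<bar>y\<bar>)" for y
      proof -
        have "Re w * y \<le> \<bar>Re w\<bar> * \<bar>y\<bar>" by (metis abs_ge_self abs_mult)
        also have "\<dots> \<le> (norm w + 1) * \<bar>y\<bar>"
          using abs_Re_le_cmod[of w] by (intro mult_right_mono) auto
        finally show ?thesis by simp
      qed
      then show "AE y in lborel. norm (exp (w * of_real y) * v y) \<le> norm (exp ((norm w + 1) * \<bar>y\<bar>) * norm (v y))"
        by (intro AE_I2) (auto simp: norm_mult intro!: mult_right_mono)
    qed measurable
    then show ?thesis by (simp add: has_bochner_integral_iff R_def)
  qed
  have L_int: "has_bochner_integral lborel
      (\<lambda>y. indicator {..<b} y *\<^sub>R (exp (w * of_real y) * HL_kernel a z (of_real (exp y)))) (L w)"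
    if w: "0 < Re w" for w
  proof -
    have "indicator {..<b} y *\<^sub>R (exp (w * of_real y) * (\<Sum>n. c n * of_real (exp y) ^ n)) =
        indicator {..<b} y *\<^sub>R (exp (w * of_real y) * HL_kernel a z (of_real (exp y)))" for y
    proof (cases "y < b")
      case True
      then have "exp y < d" using d by (metis b_def exp_less_cancel_iff exp_ln)
      then show ?thesis
        using power_series[of "exp y"] by (simp add: sums_iff del: of_real_exp)
    qed simp
    then show ?thesis
      using has_bochner_integral_exp_power_series(1)[OF d c w] by (simp only: L_def b_def)
  qed
  have g_eq: "g w = rGamma w * (R w + pole w + L w)" if w: "0 < Re w" for w
  proof -
    have "exp (w * of_real b) * S w = rGamma w * L w"
    proof -
      have nz: "w + of_nat n \<noteq> 0" for n
        using w by (metis add_pos_nonneg less_irrefl of_nat_0_le_iff plus_complex.sel(1) complex_Re_of_nat zero_complex.sel(1))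
      have term_eq: "rGamma w * (c n * of_real d ^ n * exp (w * of_real b) / (w + of_nat n)) =
          exp (w * of_real b) * (c n * of_real d ^ n * (pochhammer w n * rGamma (w + of_nat n + 1)))" for n
        using nz[of n] by (subst rGamma_pochhammer_Suc[of w n]) simp
      have sm: "summable (\<lambda>n. c n * of_real d ^ n * exp (w * of_real b) / (w + of_nat n))"
        using has_bochner_integral_exp_power_series(2)[OF d c w] by (simp add: b_def)
      have "rGamma w * L w = (\<Sum>n. exp (w * of_real b) * (c n * of_real d ^ n * (pochhammer w n * rGamma (w + of_nat n + 1))))"
        unfolding L_def using suminf_mult[OF sm, of "rGamma w"] by (simp only: term_eq)
      also have "\<dots> = exp (w * of_real b) * S w"
      proof -
        have "summable (\<lambda>n. exp (w * of_real b) * (c n * of_real d ^ n * (pochhammer w n * rGamma (w + of_nat n + 1))))"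
          using summable_mult[OF sm, of "rGamma w"] by (simp only: term_eq)
        then show ?thesis
          unfolding S_def by (subst suminf_mult) (simp_all add: summable_cmult_iff)
      qed
      finally show ?thesis by simp
    qed
    then show ?thesis by (simp add: g_def distrib_left)
  qed
  have g_hol: "g holomorphic_on HLZ_dom z"
  proof -
    have "pole holomorphic_on HLZ_dom z"
    proof (cases "z = 1")
      case True
      then show ?thesis
        unfolding pole_def by (intro holomorphic_intros) (auto simp: HLZ_dom_def)
    qed (simp add: pole_def e_def)
    moreover have "S holomorphic_on UNIV"
      unfolding S_def using c d
      by (intro holomorphic_rGamma_partial_fractions) (simp add: norm_mult norm_power)
    ultimately show ?thesis
      unfolding g_def using R_hol
      by (intro holomorphic_intros) (auto intro: holomorphic_on_subset)
  qed
  have g_sums: "(\<lambda>n. z ^ n * complex_of_real (real n + a) powr (- w)) sums g w" if w: "1 < Re w" for w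
  proof -
    \<comment> \<open>Below \<open>b\<close> the kernel lacks the term \<open>e * exp (- y)\<close>.
      For \<open>1 < Re w\<close> this term is integrable there against \<open>exp (w * y)\<close>;
      adding it back restores \<open>h\<close> on the whole line.\<close>
    have "has_bochner_integral lborel
        (\<lambda>y. e * (indicator {..<b} y *\<^sub>R exp ((w - 1) * of_real y))) (pole w)"
      using has_bochner_integral_mult_right[of e, OF has_bochner_integral_exp_lessThan[of "w - 1" b]] w
      by (simp add: pole_def)
    from has_bochner_integral_add[OF has_bochner_integral_add[OF R_int[of w] this] L_int[of w]] w
    have "has_bochner_integral lborel (\<lambda>y. exp (w * of_real y) * v y +
        e * (indicator {..<b} y *\<^sub>R exp ((w - 1) * of_real y)) +
        indicator {..<b} y *\<^sub>R (exp (w * of_real y) * HL_kernel a z (of_real (exp y)))) (R w + pole w + L w)"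
      by simp
    moreover have "exp (w * of_real y) * v y +
        e * (indicator {..<b} y *\<^sub>R exp ((w - 1) * of_real y)) +
        indicator {..<b} y *\<^sub>R (exp (w * of_real y) * HL_kernel a z (of_real (exp y))) =
        exp (w * of_real y) * h y" for y
      unfolding kernel
      by (cases "y < b") (auto simp: v_def left_diff_distrib right_diff_distrib exp_diff exp_minus divide_inverse)
    ultimately have "has_bochner_integral lborel (\<lambda>y. exp (w * of_real y) * h y) (R w + pole w + L w)"
      by simp
    then have "(\<lambda>n. Gamma w * (z ^ n * of_real (real n + a) powr (- w))) sums (R w + pole w + L w)"
      using Gamma_Dirichlet_series(2)[OF a z w] by (simp add: h_def has_bochner_integral_iff)
    from sums_mult[OF this, of "rGamma w"]
    have "(\<lambda>n. (rGamma w * Gamma w) * (z ^ n * of_real (real n + a) powr (- w))) sums g w"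
      using w by (simp add: g_eq mult.assoc)
    moreover have "rGamma w * Gamma w = 1"
      using w by (subst mult.commute) (intro Gamma_mult_rGamma, simp)
    ultimately show ?thesis by simp
  qed
  have "s \<in> HLZ_dom z"
    using z1 by (auto simp: HLZ_dom_def)
  from HLPhi_eqI[OF g_hol g_sums this]
  have "Gamma s * HLPhi s a z = (Gamma s * rGamma s) * (R s + pole s + L s)"
    using s by (simp add: g_eq mult.assoc)
  also have "Gamma s * rGamma s = 1"
    using s by (rule Gamma_mult_rGamma)
  finally have val: "Gamma s * HLPhi s a z = R s + pole s + L s" by simp

  \<comment> \<open>Now the same value \<open>pole s\<close> is obtained by subtracting the term
    above \<open>b\<close>, which completes \<open>h\<close> to the full kernel there. For
    \<open>z = 1\<close> this uses \<open>Re s < 1\<close>.\<close>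
  have "has_bochner_integral lborel
      (\<lambda>y. - e * (indicator {b..} y *\<^sub>R exp ((s - 1) * of_real y))) (pole s)"
  proof (cases "z = 1")
    case True
    then show ?thesis
      using has_bochner_integral_mult_right[of "- e", OF has_bochner_integral_exp_atLeast[of "s - 1" b]] z1
      by (simp add: pole_def)
  qed (simp add: e_def pole_def has_bochner_integral_zero)
  from has_bochner_integral_add[OF has_bochner_integral_add[OF R_int[of s] this] L_int[OF s]]
  have "has_bochner_integral lborel (\<lambda>y. exp (s * of_real y) * v y +
        - e * (indicator {b..} y *\<^sub>R exp ((s - 1) * of_real y)) +
        indicator {..<b} y *\<^sub>R (exp (s * of_real y) * HL_kernel a z (of_real (exp y)))) (Gamma s * HLPhi s a z)"
    unfolding val .
  moreover have "exp (s * of_real y) * v y +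
        - e * (indicator {b..} y *\<^sub>R exp ((s - 1) * of_real y)) +
        indicator {..<b} y *\<^sub>R (exp (s * of_real y) * HL_kernel a z (of_real (exp y))) =
        exp (s * of_real y) * HL_kernel a z (of_real (exp y))" for y
    unfolding kernel
    by (cases "y < b") (auto simp: v_def left_diff_distrib right_diff_distrib exp_diff exp_minus divide_inverse)
  ultimately show ?thesis
    by (simp only:)
qed

section \<open>Characteristic functions and signed densities\<close>

text \<open>Serves to carry integration rules for bounded real functions over to
  \<open>char\<close>, and to read off that \<open>char M (- t)\<close> is the conjugate of
  \<open>char M t\<close>.\<close>

lemma (in real_distribution) char_eq_cos_sin:
  "char M t = of_real (LINT x|M. cos (t * x)) + \<i> * of_real (LINT x|M. sin (t * x))"
proof -
  have [simp]: "integrable M (\<lambda>x. cos (t * x))" "integrable M (\<lambda>x. sin (t * x))"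
    by (auto intro!: integrable_const_bound[of _ 1])
  have "char M t = (CLINT x|M. of_real (cos (t * x)) + \<i> * of_real (sin (t * x)))"
    unfolding char_def
    by (intro Bochner_Integration.integral_cong) (simp_all only: exp_Euler cos_of_real sin_of_real)
  then show ?thesis
    by simp
qed

text \<open>The mixture is a two-stage experiment: a coin with success probability \<open>p\<close>
  decides whether to draw from \<open>M\<close> or from \<open>D\<close>.\<close>

lemma real_distribution_mixture:
  assumes M: "real_distribution M" and D: "real_distribution D" and p: "0 \<le> p" "p \<le> 1"
  obtains N where "real_distribution N"
    "\<And>A. A \<in> sets borel \<Longrightarrow> emeasure N A = ennreal p * emeasure M A + ennreal (1 - p) * emeasure D A"
    "\<And>t. char N t = of_real p * char M t + of_real (1 - p) * char D t"
proof -
  interpret M: real_distribution M by fact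
  interpret D: real_distribution D by fact
  define B where "B = measure_pmf (bernoulli_pmf p)"
  define K where "K = (\<lambda>b. if b then M else D)"
  define N where "N = B \<bind> K"
  have K: "K b \<in> space (prob_algebra borel)" for b
    by (auto simp: K_def space_prob_algebra M.prob_space_axioms D.prob_space_axioms)
  then have K': "K b \<in> space (subprob_algebra borel)" for b
    by (auto simp: space_prob_algebra space_subprob_algebra prob_space_imp_subprob_space)
  from K'[of True] K'[of False] have MD: "M \<in> space (subprob_algebra borel)" "D \<in> space (subprob_algebra borel)"
    by (simp_all add: K_def)
  have [measurable]: "K \<in> measurable B (subprob_algebra borel)"
    using K' by (auto simp: B_def)
  have spB: "space B = UNIV" by (simp add: B_def)
  have sets_N: "sets N = sets borel"
    unfolding N_def by (intro sets_bind) (auto simp: spB K_def)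
  have "prob_space N"
    unfolding N_def B_def
    by (intro prob_space.prob_space_bind[where S = borel] measure_pmf.prob_space_axioms)
       (use K' K in \<open>auto simp: space_prob_algebra\<close>)
  then interpret N: real_distribution N
    by (auto simp: real_distribution_def real_distribution_axioms_def sets_N)
  have em: "emeasure N A = ennreal p * emeasure M A + ennreal (1 - p) * emeasure D A"
    if "A \<in> sets borel" for A
    unfolding N_def using that p
    by (subst emeasure_bind[where N = borel]) (auto simp: spB B_def K_def MD mult.commute)
  have int: "(LINT x|N. u x) = p * (LINT x|M. u x) + (1 - p) * (LINT x|D. u x)"
    if [measurable]: "u \<in> borel_measurable borel" and "\<And>x. \<bar>u x\<bar> \<le> 1" for u :: "real \<Rightarrow> real"
    unfolding N_def
    by (subst integral_bind[where K = borel and B = 1 and B' = 1])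
       (use p that in \<open>auto simp: B_def K_def MD measure_pmf.finite_measure_axioms
          M.emeasure_space_1[simplified] D.emeasure_space_1[simplified]\<close>)
  have "char N t = of_real p * char M t + of_real (1 - p) * char D t" for t
    unfolding M.char_eq_cos_sin D.char_eq_cos_sin N.char_eq_cos_sin
    by (subst (1 2) int) (auto simp: algebra_simps)
  with em show thesis
    using N.real_distribution_axioms that by blast
qed

lemma char_density:
  fixes f :: "real \<Rightarrow> real"
  assumes [measurable]: "f \<in> borel_measurable borel" and "\<And>y. 0 \<le> f y"
  shows "char (density lborel f) t = (CLINT y|lborel. iexp (t * y) * f y)"
  unfolding char_def using assms(2)
  by (subst integral_density) (auto simp: scaleR_conv_of_real mult.commute)

lemma real_distribution_density:
  fixes f :: "real \<Rightarrow> real"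
  assumes f: "integrable lborel f" and nonneg: "\<And>y. 0 \<le> f y" and one: "(LINT y|lborel. f y) = 1"
  shows "real_distribution (density lborel f)"
proof -
  have [measurable]: "f \<in> borel_measurable borel" using f by auto
  have "emeasure (density lborel f) UNIV = ennreal (LINT y|lborel. f y)"
    using f nonneg by (simp add: emeasure_density nn_integral_eq_integral)
  then have "prob_space (density lborel f)"
    by (intro prob_spaceI) (simp add: one)
  then show ?thesis
    by (auto simp: real_distribution_def real_distribution_axioms_def)
qed

lemma integrable_iexp_mult:
  fixes f :: "real \<Rightarrow> real"
  assumes f: "integrable lborel f"
  shows "integrable lborel (\<lambda>y. iexp (t * y) * of_real (f y))"
proof -
  have [measurable]: "f \<in> borel_measurable borel" using f by auto
  show ?thesis
    by (rule Bochner_Integration.integrable_bound[OF f]) (auto simp: norm_mult)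
qed

text \<open>Adding the negative part of g to M and normalising turns the hypothesis into an equality of
  the characteristic functions of two genuine probability measures.\<close>
lemma char_eq_integral_imp_nonneg:
  fixes g :: "real \<Rightarrow> real"
  assumes M: "real_distribution M" and g: "integrable lborel g"
    and char: "\<And>t. char M t = (CLINT y|lborel. iexp (t * y) * g y)"
  shows "AE y in lborel. 0 \<le> g y"
proof -
  interpret M: real_distribution M by fact
  have [measurable]: "g \<in> borel_measurable borel" using g by auto
  define gp gm where "gp = (\<lambda>y. max 0 (g y))" and "gm = (\<lambda>y. max 0 (- g y))"
  have gpm: "gp y - gm y = g y" "0 \<le> gp y" "0 \<le> gm y" for y
    by (auto simp: gp_def gm_def)
  have int: "integrable lborel gp" "integrable lborel gm"
    using g by (auto simp: gp_def gm_def intro!: integrable_max)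
  define d where "d = (LINT y|lborel. gm y)"
  have d_nonneg: "0 \<le> d" unfolding d_def using gpm by (intro integral_nonneg_AE) auto
  have "of_real (LINT y|lborel. g y) = (1 :: complex)"
    using char[of 0] M.char_zero by (simp flip: integral_complex_of_real)
  then have "(LINT y|lborel. gp y) - d = 1"
    unfolding d_def using int gpm(1) by (simp flip: Bochner_Integration.integral_diff)
  then have gp1: "(LINT y|lborel. gp y) = 1 + d" by simp
  have "AE y in lborel. gm y = 0"
  proof (cases "d = 0")
    case True
    then show ?thesis
      using integral_nonneg_eq_0_iff_AE[OF int(2)] gpm by (auto simp: d_def)
  next
    case False
    with d_nonneg have d: "0 < d" by simp
    define D where "D = density lborel (\<lambda>y. ennreal (gm y / d))"
    define E where "E = density lborel (\<lambda>y. ennreal (gp y / (1 + d)))"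
    have D: "real_distribution D" unfolding D_def
      using d int gpm by (intro real_distribution_density) (auto simp: d_def)
    have E: "real_distribution E" unfolding E_def
      using d int gpm gp1 by (intro real_distribution_density) auto
    \<comment> \<open>The negative part has mass \<open>d\<close>, so \<open>M\<close> plus the
      measure with density \<open>gm\<close> has mass \<open>1 + d\<close>, the same as that of
      \<open>gp\<close>. Dividing by \<open>1 + d\<close> gives the weights
      \<open>1 / (1 + d)\<close> of \<open>M\<close> and \<open>d / (1 + d)\<close> of
      \<open>D\<close>.\<close>
    obtain N where N: "real_distribution N"
      and emN: "\<And>A. A \<in> sets borel \<Longrightarrow> emeasure N A =
          ennreal (1 / (1 + d)) * emeasure M A + ennreal (1 - 1 / (1 + d)) * emeasure D A"
      and chN: "\<And>t. char N t = of_real (1 / (1 + d)) * char M t + of_real (1 - 1 / (1 + d)) * char D t"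
      using real_distribution_mixture[OF M D, of "1 / (1 + d)"] d by auto
    have "char N t = char E t" for t
    proof -
      have 1: "char D t = (CLINT y|lborel. iexp (t * y) * gm y) / d"
        unfolding D_def by (subst char_density) (use d gpm int in auto)
      have 2: "char E t = (CLINT y|lborel. iexp (t * y) * gp y) / (1 + d)"
        unfolding E_def by (subst char_density) (use d gpm int in auto)
      have 3: "char M t = (CLINT y|lborel. iexp (t * y) * gp y) - (CLINT y|lborel. iexp (t * y) * gm y)"
        unfolding char
        using integrable_iexp_mult[OF int(1), of t] integrable_iexp_mult[OF int(2), of t]
        by (subst Bochner_Integration.integral_diff[symmetric])
           (simp_all only: right_diff_distrib[symmetric] of_real_diff[symmetric] gpm(1))
      have alg: "1 / (1 + c) * (u - v) + (1 - 1 / (1 + c)) * (v / c) = u / (1 + c)"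
        if "1 + c \<noteq> 0" "c \<noteq> 0" for c u v :: complex
      proof -
        have "1 - 1 / (1 + c) = c / (1 + c)"
          using that by (simp add: field_simps)
        then show ?thesis
          using that by (simp add: diff_divide_distrib)
      qed
      have "complex_of_real (1 + d) \<noteq> 0" "complex_of_real d \<noteq> 0"
        using d by (simp_all del: of_real_add)
      then show ?thesis
        unfolding chN 1 2 3 using alg[of "of_real d"] by simp
    qed
    then have "N = E"
      using Levy_uniqueness N E by blast
    \<comment> \<open>The density of \<open>E\<close> vanishes on \<open>A\<close>, so
      \<open>N\<close> gives \<open>A\<close> mass zero; \<open>D\<close>, having positive weight in
      \<open>N\<close>, does too. Hence \<open>gm\<close> is almost everywhere zero on
      \<open>A\<close>, and off \<open>A\<close> it is zero anyway.\<close>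
    define A where "A = {y. g y < 0}"
    have A: "A \<in> sets borel" unfolding A_def by measurable
    have "emeasure E A = 0"
      unfolding E_def using A
      by (subst emeasure_density) (auto simp: nn_integral_0_iff_AE A_def gp_def indicator_def)
    then have "ennreal (1 - 1 / (1 + d)) * emeasure D A = 0"
      using emN[OF A] \<open>N = E\<close> by simp
    then have "emeasure D A = 0"
      using d by (auto simp: ennreal_eq_0_iff field_simps)
    then have "AE y in lborel. ennreal (gm y / d) * indicator A y = 0"
      unfolding D_def using A int
      by (subst (asm) emeasure_density) (auto simp: nn_integral_0_iff_AE)
    then show ?thesis
      by eventually_elim (use d gpm in \<open>auto simp: A_def gm_def indicator_def ennreal_eq_0_iff
         divide_le_0_iff split: if_splits\<close>)
  qed
  then show ?thesis
    by eventually_elim (auto simp: gm_def)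
qed

text \<open>By continuity the set where \<open>g\<close> is negative is open, and an open Lebesgue
  null set is empty.\<close>

lemma continuous_AE_nonneg_imp:
  fixes g :: "real \<Rightarrow> real"
  assumes "AE y in lborel. 0 \<le> g y" "continuous_on UNIV g"
  shows "0 \<le> g y"
proof (rule ccontr)
  assume neg: "\<not> 0 \<le> g y"
  have "open {y. g y < 0}"
    using assms(2) by (intro open_Collect_less) auto
  moreover have "{y. g y < 0} \<in> null_sets lborel"
    using assms(1) calculation by (subst (asm) AE_iff_null) (auto simp: not_le)
  ultimately have "{y. g y < 0} = {}"
    by (metis negligible_iff_null_sets null_sets_completionI open_not_negligible)
  with neg show False by (auto simp: not_le)
qed

section \<open>Sign of the kernel\<close>

lemma AE_lborel_not_False: "\<not> (AE y in (lborel :: real measure). False)"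
  by (auto simp: eventually_ae_filter null_sets_def dest!: top_le)

text \<open>Since \<open>M\<close> lives on the real line, the conjugate of \<open>g\<close> has the
  same transform as \<open>g\<close>, and so has \<open>Re g + c * Im g\<close> for every real
  \<open>c\<close>. The real case makes all these functions nonnegative, which forces
  \<open>Im g = 0\<close>.\<close>

lemma char_eq_complex_integral_imp_nonneg:
  fixes g :: "real \<Rightarrow> complex"
  assumes M: "real_distribution M" and g: "integrable lborel g" and cont: "continuous_on UNIV g"
    and char: "\<And>t. char M t = (CLINT y|lborel. iexp (t * y) * g y)"
  shows "Im (g y) = 0" "0 \<le> Re (g y)"
proof -
  interpret M: real_distribution M by fact
  have [measurable]: "g \<in> borel_measurable borel" using g by auto
  have [measurable]: "(\<lambda>y. cnj (g y)) \<in> borel_measurable borel"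
    by (rule measurable_compose[of g _ borel cnj]) (auto intro!: borel_measurable_continuous_onI continuous_intros)
  have int: "integrable lborel (\<lambda>y. iexp (t * y) * g y)" "integrable lborel (\<lambda>y. iexp (t * y) * cnj (g y))" for t
    by (rule Bochner_Integration.integrable_bound[OF g]; auto simp: norm_mult)+
  have char_cnj: "char M t = (CLINT y|lborel. iexp (t * y) * cnj (g y))" for t
  proof -
    have "char M t = cnj (char M (- t))"
      unfolding M.char_eq_cos_sin by simp
    also have "\<dots> = (CLINT y|lborel. cnj (iexp (- t * y) * g y))"
      unfolding char by (rule Bochner_Integration.integral_cnj[symmetric])
    also have "\<dots> = (CLINT y|lborel. iexp (t * y) * cnj (g y))"
      by (intro Bochner_Integration.integral_cong) (auto simp: exp_cnj)
    finally show ?thesis .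
  qed
  have lin: "0 \<le> Re (g y) + c * Im (g y)" for c y
  proof -
    have "AE y in lborel. 0 \<le> Re (g y) + c * Im (g y)"
    proof (rule char_eq_integral_imp_nonneg[OF M])
      show "integrable lborel (\<lambda>y. Re (g y) + c * Im (g y))"
        using g by (intro Bochner_Integration.integrable_add integrable_mult_right integrable_Re integrable_Im)
      \<comment> \<open>The coefficients of \<open>g\<close> and its conjugate in
        \<open>Re g + c * Im g\<close>; they add up to 1, so the transform is unchanged.\<close>
      define u v where "u = (1 / 2 - \<i> * c / 2 :: complex)" and "v = (1 / 2 + \<i> * c / 2 :: complex)"
      have eq: "of_real (Re w + c * Im w) = u * w + v * cnj w" for w
        by (simp add: u_def v_def complex_eq_iff field_simps)
      show "char M t = (CLINT y|lborel. iexp (t * y) * of_real (Re (g y) + c * Im (g y)))" for t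
      proof -
        have "(CLINT y|lborel. iexp (t * y) * of_real (Re (g y) + c * Im (g y))) =
            (CLINT y|lborel. u * (iexp (t * y) * g y) + v * (iexp (t * y) * cnj (g y)))"
          unfolding eq by (simp add: algebra_simps)
        also have "\<dots> = u * char M t + v * char M t"
          using int[of t] by (subst Bochner_Integration.integral_add)
            (simp_all only: integrable_mult_right integral_mult_right_zero char[symmetric] char_cnj[symmetric])
        also have "\<dots> = char M t"
          by (simp add: u_def v_def flip: distrib_right)
        finally show ?thesis by simp
      qed
    qed
    then show ?thesis
      by (rule continuous_AE_nonneg_imp) (intro continuous_intros cont)
  qed
  show "0 \<le> Re (g y)" using lin[of y 0] by simp
  show "Im (g y) = 0"
  proof (rule ccontr)
    assume "Im (g y) \<noteq> 0"
    then show False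
      \<comment> \<open>This \<open>c\<close> makes the combination equal to -1.\<close>
      using lin[of y "- (Re (g y) + 1) / Im (g y)"] by simp
  qed
qed

text \<open>The right side is \<open>2 * sinh (x / 2)\<close>; its difference to \<open>x\<close>
  has derivative \<open>cosh (x / 2) - 1\<close>, which is positive because
  \<open>(exp (x / 2) - 1)\<^sup>2\<close> is.\<close>

lemma less_exp_half_diff:
  fixes x :: real
  assumes "0 < x"
  shows "x < exp (x / 2) - exp (- (x / 2))"
proof -
  define f where "f = (\<lambda>x::real. exp (x / 2) - exp (- (x / 2)) - x)"
  have "f 0 < f x"
  proof (rule DERIV_pos_imp_increasing_open[OF assms])
    fix y :: real assume y: "0 < y" "y < x"
    have "(f has_real_derivative (exp (y / 2) + exp (- (y / 2))) / 2 - 1) (at y)"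
      unfolding f_def by (auto intro!: derivative_eq_intros)
    moreover have "(exp (y / 2) + exp (- (y / 2))) / 2 - 1 > 0"
    proof -
      have "0 < (exp (y / 2) - 1)\<^sup>2" using y by simp
      then have "2 * exp (y / 2) < exp (y / 2) * exp (y / 2) + 1"
        by (simp add: power2_eq_square algebra_simps)
      then have "2 * exp (y / 2) < (exp (y / 2) + exp (- (y / 2))) * exp (y / 2)"
        by (simp add: distrib_right flip: exp_add)
      then have "2 < exp (y / 2) + exp (- (y / 2))"
        by (simp only: mult_less_cancel_right_pos exp_gt_zero)
      then show ?thesis by simp
    qed
    ultimately show "\<exists>l. (f has_real_derivative l) (at y) \<and> 0 < l" by blast
  qed (auto simp: f_def intro!: continuous_intros)
  then show ?thesis by (simp add: f_def)
qed

text \<open>Clearing denominators, \<open>x * exp ((1 - a) * x)\<close> must stay below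
  \<open>exp x - 1\<close>, which is \<open>2 * sinh (x / 2) * exp (x / 2)\<close>; the exponent
  \<open>1 - a\<close> is at most \<open>1 / 2\<close>.\<close>

lemma kernel_neg:
  fixes a x :: real
  assumes a: "1 / 2 \<le> a" and x: "0 < x"
  shows "exp ((1 - a) * x) / (exp x - 1) - 1 / x < 0"
proof -
  have "x * exp ((1 - a) * x) \<le> x * exp (x / 2)"
    using a x mult_right_mono[of "1 - a" "1 / 2" x] by (intro mult_left_mono) auto
  also have "\<dots> < (exp (x / 2) - exp (- (x / 2))) * exp (x / 2)"
    using less_exp_half_diff[OF x] by (intro mult_strict_right_mono) auto
  also have "\<dots> = exp x - 1"
    by (simp add: left_diff_distrib flip: exp_add)
  finally show ?thesis
    using x by (simp add: field_simps)
qed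

text \<open>Near 0 the kernel tends to \<open>1 / 2 - a\<close>, which is positive; at infinity its
  first term decays like \<open>exp (- a * x)\<close> and loses against
  \<open>1 / x\<close>.\<close>

lemma kernel_changes_sign:
  fixes a :: real
  assumes a: "0 < a" "a < 1 / 2"
  obtains x y where "0 < x" "0 < y" "0 < exp ((1 - a) * x) / (exp x - 1) - 1 / x"
    "exp ((1 - a) * y) / (exp y - 1) - 1 / y < 0"
proof -
  have lim: "((\<lambda>x. exp ((1 - a) * x) / (exp x - 1) - 1 / x) \<longlongrightarrow> 1 / 2 - a) (at_right 0)"
    by real_asymp
  have "\<forall>\<^sub>F x in at_right 0. 0 < exp ((1 - a) * x) / (exp x - 1) - 1 / x"
    using a by (intro order_tendstoD(1)[OF lim]) auto
  then have "\<forall>\<^sub>F x in at_right 0. 0 < x \<and> 0 < exp ((1 - a) * x) / (exp x - 1) - 1 / x"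
    using eventually_at_right_less by (rule eventually_conj[rotated])
  then obtain x where x: "0 < x" "0 < exp ((1 - a) * x) / (exp x - 1) - 1 / x"
    using eventually_happens'[OF trivial_limit_at_right_real] by blast
  have "((\<lambda>x. x * (exp ((1 - a) * x) / (exp x - 1))) \<longlongrightarrow> 0) at_top"
    using a by real_asymp
  then have "\<forall>\<^sub>F x in at_top. x * (exp ((1 - a) * x) / (exp x - 1)) < 1"
    by (intro order_tendstoD(2)) auto
  then obtain y where y: "0 < y" "y * (exp ((1 - a) * y) / (exp y - 1)) < 1"
    using eventually_happens'[OF trivial_limit_at_top_linorder eventually_conj[OF _ eventually_gt_at_top[of 0]]] by blast
  then have "exp ((1 - a) * y) / (exp y - 1) < 1 / y"
    by (simp add: field_simps)
  with x y(1) that show thesis by force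
qed

section \<open>Fourier representation of \<open>f_HL\<close> and nonnegativity of the normalised
  kernel\<close>

lemma f_HL_has_bochner_integral:
  assumes a: "0 < a" and z: "norm z \<le> 1" and \<sigma>: "0 < \<sigma>" and z1: "z = 1 \<Longrightarrow> \<sigma> < 1"
  shows "has_bochner_integral lborel
    (\<lambda>y. iexp (t * y) * (of_real (exp (\<sigma> * y)) * HL_kernel a z (of_real (exp y)))) (f_HL \<sigma> a z t)"
proof -
  have "exp (Complex \<sigma> t * of_real y) = iexp (t * y) * of_real (exp (\<sigma> * y))" for y
  proof -
    have "Complex \<sigma> t * of_real y = \<i> * of_real (t * y) + of_real (\<sigma> * y)"
      by (simp add: complex_eq_iff)
    then show ?thesis by (simp only: exp_add exp_of_real)
  qed
  with Gamma_HLPhi_has_bochner_integral[OF a z, of "Complex \<sigma> t"] \<sigma> z1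
  show ?thesis by (simp add: f_HL_def mult.assoc)
qed

lemma continuous_on_HL_kernel:
  assumes "norm z \<le> 1"
  shows "continuous_on UNIV (\<lambda>y. HL_kernel a z (of_real (exp y)))"
proof -
  have "exp (complex_of_real (exp y)) - z \<noteq> 0" for y
    using exp_ne_of_norm_le_1[OF assms, of "exp y"] by simp
  then show ?thesis
    unfolding HL_kernel_def by (cases "z = 1") (auto intro!: continuous_intros)
qed

text \<open>Positivity of a complex density with a given characteristic function is applied to the
  normalised integrand, whose positive factor \<open>exp (\<sigma> * y)\<close> can then be
  dropped.\<close>

lemma F_HL_kernel_nonneg:
  assumes a: "0 < a" and z: "norm z \<le> 1" and \<sigma>: "0 < \<sigma>" and z1: "z = 1 \<Longrightarrow> \<sigma> < 1"
    and M: "real_distribution M" and char: "char M = F_HL \<sigma> a z"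
  shows "f_HL \<sigma> a z 0 \<noteq> 0"
    and "Im (HL_kernel a z (of_real (exp y)) / f_HL \<sigma> a z 0) = 0"
    and "0 \<le> Re (HL_kernel a z (of_real (exp y)) / f_HL \<sigma> a z 0)"
proof -
  \<comment> \<open>If \<open>f_HL \<sigma> a z 0\<close> were 0, division by zero would make this
    value 0.\<close>
  have "F_HL \<sigma> a z 0 = 1"
    using real_distribution.char_zero[OF M] by (simp add: char)
  then show "f_HL \<sigma> a z 0 \<noteq> 0"
    by (auto simp: F_HL_def)
  note f = f_HL_has_bochner_integral[OF a z \<sigma> z1]
  define g where "g = (\<lambda>y. of_real (exp (\<sigma> * y)) * HL_kernel a z (of_real (exp y)) / f_HL \<sigma> a z 0)"
  have "integrable lborel g"
    using f[of 0] by (simp add: g_def has_bochner_integral_iff)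
  moreover have "continuous_on UNIV g"
    unfolding g_def divide_inverse
    by (intro continuous_intros continuous_on_HL_kernel z)
  moreover have "char M t = (CLINT y|lborel. iexp (t * y) * g y)" for t
    using f[of t] by (simp add: char F_HL_def g_def has_bochner_integral_iff flip: integral_divide_zero)
  ultimately have g: "Im (g y) = 0" "0 \<le> Re (g y)"
    using char_eq_complex_integral_imp_nonneg[OF M] by blast+
  define q where "q = HL_kernel a z (of_real (exp y)) / f_HL \<sigma> a z 0"
  have "g y = of_real (exp (\<sigma> * y)) * q"
    by (simp add: g_def q_def)
  with g have "Im q = 0" "0 \<le> Re q"
    by (simp_all add: zero_le_mult_iff)
  then show "Im (HL_kernel a z (of_real (exp y)) / f_HL \<sigma> a z 0) = 0"
      "0 \<le> Re (HL_kernel a z (of_real (exp y)) / f_HL \<sigma> a z 0)"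
    by (simp_all only: q_def)
qed

text \<open>The constant \<open>c\<close> only records the sign of the kernel, so that negative
  kernels (\<open>z = 1\<close>) and positive ones are treated together. The integral
  \<open>k\<close> has the same sign as \<open>K\<close>, hence the quotient is a probability
  density.\<close>

lemma F_HL_eq_char_density:
  fixes K :: "real \<Rightarrow> real" and c :: real
  assumes a: "0 < a" and z: "norm z \<le> 1" and \<sigma>: "0 < \<sigma>" and z1: "z = 1 \<Longrightarrow> \<sigma> < 1"
    and K: "\<And>y. HL_kernel a z (of_real (exp y)) = of_real (K y)" and sign: "\<And>y. 0 < c * K y"
  obtains k where "f_HL \<sigma> a z 0 = complex_of_real k"
    "real_distribution (density lborel (\<lambda>y. ennreal (exp (y * \<sigma>) * K y / k)))"
    "char (density lborel (\<lambda>y. ennreal (exp (y * \<sigma>) * K y / k))) = F_HL \<sigma> a z"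
proof -
  define k where "k = (LINT y|lborel. exp (\<sigma> * y) * K y)"
  note f = f_HL_has_bochner_integral[OF a z \<sigma> z1, unfolded K, folded of_real_mult]
  have "integrable lborel (\<lambda>y. complex_of_real (exp (\<sigma> * y) * K y))"
    using f[of 0] by (simp add: has_bochner_integral_iff)
  then have int: "integrable lborel (\<lambda>y. exp (\<sigma> * y) * K y)"
    by (simp only: complex_of_real_integrable_eq)
  have fk: "f_HL \<sigma> a z 0 = complex_of_real k"
    using f[of 0] by (simp add: has_bochner_integral_iff k_def flip: integral_complex_of_real)
  have pos: "0 < c * (exp (\<sigma> * y) * K y)" for y
    using mult_pos_pos[OF exp_gt_zero[of "\<sigma> * y"] sign[of y]] by (simp add: mult_ac)
  have "0 < c * k"
  proof -
    have "c * k = (LINT y|lborel. c * (exp (\<sigma> * y) * K y))"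
      by (simp add: k_def)
    moreover have "0 \<le> (LINT y|lborel. c * (exp (\<sigma> * y) * K y))"
      using pos by (intro integral_nonneg_AE AE_I2 less_imp_le)
    moreover have "(LINT y|lborel. c * (exp (\<sigma> * y) * K y)) \<noteq> 0"
    proof
      assume "(LINT y|lborel. c * (exp (\<sigma> * y) * K y)) = 0"
      then have "AE y in lborel. c * (exp (\<sigma> * y) * K y) = 0"
        using pos by (subst (asm) integral_nonneg_eq_0_iff_AE)
          (auto intro!: integrable_mult_right int AE_I2 less_imp_le)
      then have "AE y in (lborel :: real measure). False"
        by eventually_elim (use pos in \<open>metis less_irrefl\<close>)
      with AE_lborel_not_False show False by blast
    qed
    ultimately show ?thesis by linarith
  qed
  define p where "p = (\<lambda>y. exp (y * \<sigma>) * K y / k)"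
  have "0 \<le> p y" for y
  proof -
    have "p y = (c * (exp (\<sigma> * y) * K y)) / (c * k)"
      using \<open>0 < c * k\<close> by (auto simp: p_def mult_ac)
    then show ?thesis using pos[of y] \<open>0 < c * k\<close> by (metis divide_nonneg_pos less_imp_le)
  qed
  moreover have int_p: "integrable lborel p"
    using int by (simp add: p_def mult.commute)
  moreover have "(LINT y|lborel. p y) = 1"
    using \<open>0 < c * k\<close> by (auto simp: p_def k_def mult.commute)
  ultimately have dist: "real_distribution (density lborel p)"
    by (intro real_distribution_density) auto
  have "char (density lborel p) t = F_HL \<sigma> a z t" for t
  proof -
    have "char (density lborel p) t = (CLINT y|lborel. iexp (t * y) * p y)"
      using \<open>\<And>y. 0 \<le> p y\<close> int_p by (intro char_density) auto
    also have "\<dots> = (CLINT y|lborel. iexp (t * y) * of_real (exp (\<sigma> * y) * K y) / of_real k)"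
      by (simp add: p_def mult_ac)
    also have "\<dots> = f_HL \<sigma> a z t / of_real k"
      using f[of t] by (simp only: integral_divide_zero has_bochner_integral_iff)
    finally show ?thesis by (simp add: F_HL_def fk)
  qed
  with fk dist that show thesis
    unfolding p_def by blast
qed

section \<open>Real parameters, necessity of the conditions, and the two equivalences\<close>

lemma HL_kernel_1_of_real:
  "HL_kernel a 1 (of_real (exp y)) = of_real (exp ((1 - a) * exp y) / (exp (exp y) - 1) - 1 / exp y)"
  unfolding HL_kernel_def by (simp flip: exp_of_real)

lemma HL_kernel_of_real:
  assumes "r \<noteq> 1"
  shows "HL_kernel a (of_real r) (of_real (exp y)) = of_real (exp ((1 - a) * exp y) / (exp (exp y) - r))"
  unfolding HL_kernel_def using assms by (simp flip: exp_of_real)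

text \<open>The normalised kernel is real, so \<open>(exp (exp y) - z) * k\<close> is real for every
  \<open>y\<close>. Subtracting two such values eliminates \<open>z\<close> and shows that
  \<open>k\<close> is real; then \<open>z\<close> is real too.\<close>

lemma char_F_HL_imp_real:
  assumes a: "0 < a" and z: "norm z \<le> 1" "z \<noteq> 1" and \<sigma>: "0 < \<sigma>"
    and M: "real_distribution M" and char: "char M = F_HL \<sigma> a z"
  shows "Im z = 0"
proof -
  define k where "k = f_HL \<sigma> a z 0"
  note nn = F_HL_kernel_nonneg[OF a z(1) \<sigma> _ M char, folded k_def]
  have k: "k \<noteq> 0" using nn(1) z by simp
  have real: "(exp (of_real (exp y)) - z) * k \<in> \<real>" for y :: real
  proof -
    define e where "e = exp ((1 - a) * exp y)"
    have "HL_kernel a z (of_real (exp y)) / k = of_real e / ((exp (of_real (exp y)) - z) * k)"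
      using z by (simp add: HL_kernel_def e_def flip: exp_of_real)
    moreover have "HL_kernel a z (of_real (exp y)) / k \<in> \<real>"
      using nn(2) z by (simp add: complex_is_Real_iff)
    ultimately have "of_real e / (of_real e / ((exp (of_real (exp y)) - z) * k)) \<in> \<real>"
      by (metis Reals_divide Reals_of_real)
    then show ?thesis by (simp add: e_def)
  qed
  have "(exp (of_real (exp 1)) - z) * k - (exp (of_real (exp 0)) - z) * k =
      of_real (exp (exp 1) - exp (exp 0)) * k"
    by (simp only: exp_of_real of_real_diff) (simp only: algebra_simps)
  with Reals_diff[OF real[of 1] real[of 0]]
  have "of_real (exp (exp 1) - exp (exp 0)) * k \<in> \<real>"
    by (simp only:)
  moreover have "exp (exp 1) - exp (exp 0) \<noteq> (0::real)" by simp
  ultimately have "k \<in> \<real>"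
    by (metis Reals_divide Reals_of_real nonzero_mult_div_cancel_left of_real_eq_0_iff)
  with k real[of 0] have "exp (of_real (exp 0)) - z \<in> \<real>"
    by (metis Reals_divide nonzero_mult_div_cancel_right)
  then show ?thesis
    by (simp add: complex_is_Real_iff exp_of_real[symmetric] Im_exp)
qed

lemma in_real_segment_iff:
  fixes z :: complex
  assumes "norm z \<le> 1" "z \<noteq> 1"
  shows "z \<in> complex_of_real ` {-1..<1} \<longleftrightarrow> Im z = 0"
proof
  assume Im: "Im z = 0"
  then have z: "z = of_real (Re z)" by (simp add: complex_eq_iff)
  have "Re z \<noteq> 1" using z assms(2) by auto
  moreover have "\<bar>Re z\<bar> \<le> 1" using assms(1) abs_Re_le_cmod[of z] by linarith
  ultimately show "z \<in> complex_of_real ` {-1..<1}"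
    using z by (intro image_eqI[of _ _ "Re z"]) auto
qed auto

theorem theorem2p2:
  fixes a :: real
  assumes "0 < a" and "a \<le> 1"
  shows
   "((\<forall>\<sigma>. 0 < \<sigma> \<and> \<sigma> < 1 \<longrightarrow>
        (\<exists>M. real_distribution M \<and> char M = F_HL \<sigma> a 1)) \<longleftrightarrow> 1/2 \<le> a)
    \<and> (1/2 \<le> a \<longrightarrow> (\<forall>\<sigma> M. 0 < \<sigma> \<and> \<sigma> < 1 \<and> real_distribution M \<and>
          char M = F_HL \<sigma> a 1 \<longrightarrow>
          M = density lborel (\<lambda>y. ennreal (Re (P_HL1 \<sigma> a y)))))
    \<and> (\<forall>z::complex. 0 < norm z \<and> norm z \<le> 1 \<and> z \<noteq> 1 \<longrightarrow>
        ((\<forall>\<sigma>. 0 < \<sigma> \<longrightarrow> (\<exists>M. real_distribution M \<and> char M = F_HL \<sigma> a z))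
           \<longleftrightarrow> z \<in> complex_of_real ` {-1..<1})
        \<and> (z \<in> complex_of_real ` {-1..<1} \<longrightarrow>
            (\<forall>\<sigma> M. 0 < \<sigma> \<and> real_distribution M \<and> char M = F_HL \<sigma> a z \<longrightarrow>
               M = density lborel (\<lambda>y. ennreal (Re (P_HL \<sigma> a z y))))))"
proof -
  note a = assms(1)
  have density1: "real_distribution (density lborel (\<lambda>y. ennreal (Re (P_HL1 \<sigma> a y)))) \<and>
      char (density lborel (\<lambda>y. ennreal (Re (P_HL1 \<sigma> a y)))) = F_HL \<sigma> a 1"
    if a2: "1 / 2 \<le> a" and \<sigma>: "0 < \<sigma>" "\<sigma> < 1" for \<sigma>
  proof -
    define K where "K = (\<lambda>y. exp ((1 - a) * exp y) / (exp (exp y) - 1) - 1 / exp y)"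
    have "0 < (-1) * K y" for y
      using kernel_neg[OF a2, of "exp y"] by (simp add: K_def)
    then obtain k where k: "f_HL \<sigma> a 1 0 = complex_of_real k"
      "real_distribution (density lborel (\<lambda>y. ennreal (exp (y * \<sigma>) * K y / k)))"
      "char (density lborel (\<lambda>y. ennreal (exp (y * \<sigma>) * K y / k))) = F_HL \<sigma> a 1"
      using F_HL_eq_char_density[OF a _ \<sigma>(1), of 1 K "-1"] \<sigma>(2)
      by (auto simp: HL_kernel_1_of_real K_def)
    have "P_HL1 \<sigma> a y = complex_of_real (exp (y * \<sigma>) * K y / k)" for y
      unfolding P_HL1_def k(1) K_def by (simp only: of_real_mult of_real_divide times_divide_eq_left)
    then show ?thesis
      using k(2,3) by simp
  qed
  have half: "1 / 2 \<le> a" if ex: "\<forall>\<sigma>. 0 < \<sigma> \<and> \<sigma> < 1 \<longrightarrow> (\<exists>M. real_distribution M \<and> char M = F_HL \<sigma> a 1)"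
  proof (rule ccontr)
    assume "\<not> 1 / 2 \<le> a"
    define u where "u = (\<lambda>x. exp ((1 - a) * x) / (exp x - 1) - 1 / x)"
    obtain x x' where x: "0 < x" "0 < x'" "0 < u x" "u x' < 0"
      unfolding u_def using kernel_changes_sign[OF a] \<open>\<not> 1 / 2 \<le> a\<close> by (metis not_le)
    obtain M where M: "real_distribution M" "char M = F_HL (1 / 2) a 1"
      using ex[rule_format, of "1 / 2"] by auto
    define k where "k = f_HL (1 / 2) a 1 0"
    \<comment> \<open>Nothing is known about \<open>k\<close> except that it is a nonzero complex
      number, so realness and sign are extracted for \<open>1 / k\<close>.\<close>
    note nn = F_HL_kernel_nonneg[OF a _ _ _ M, folded k_def]
    have "k \<noteq> 0" using nn(1) by simp
    have kernel: "0 \<le> u x * Re (1 / k)" "u x * Im (1 / k) = 0" if "0 < x" for x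
    proof -
      have "HL_kernel a 1 (of_real (exp (ln x))) / k = of_real (u x) * (1 / k)"
        using that HL_kernel_1_of_real[of a "ln x"] by (simp add: u_def)
      with nn(2,3)[of "ln x"] have "Im (of_real (u x) * (1 / k)) = 0" "0 \<le> Re (of_real (u x) * (1 / k))"
        by simp_all
      then show "0 \<le> u x * Re (1 / k)" "u x * Im (1 / k) = 0"
        by (simp_all del: times_divide_eq_right)
    qed
    \<comment> \<open>The opposite signs of \<open>u\<close> at \<open>x\<close> and
      \<open>x'\<close> give the two inequalities, and \<open>u x \<noteq> 0\<close> gives the
      imaginary part.\<close>
    have "Re (1 / k) \<ge> 0" "Re (1 / k) \<le> 0" "Im (1 / k) = 0"
      using kernel[OF x(1)] kernel(1)[OF x(2)] x(3,4)
      by (auto simp: zero_le_mult_iff)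
    then have "1 / k = 0" by (simp add: complex_eq_iff)
    with \<open>k \<noteq> 0\<close> show False by simp
  qed
  have density2: "real_distribution (density lborel (\<lambda>y. ennreal (Re (P_HL \<sigma> a z y)))) \<and>
      char (density lborel (\<lambda>y. ennreal (Re (P_HL \<sigma> a z y)))) = F_HL \<sigma> a z"
    if z: "z \<in> complex_of_real ` {-1..<1}" and \<sigma>: "0 < \<sigma>" for \<sigma> z
  proof -
    obtain r where r: "z = of_real r" "-1 \<le> r" "r < 1" using z by auto
    define K where "K = (\<lambda>y. exp ((1 - a) * exp y) / (exp (exp y) - r))"
    have "norm z \<le> 1" and z1: "z = 1 \<Longrightarrow> \<sigma> < 1"
      using r by auto
    have kernel: "HL_kernel a z (of_real (exp y)) = of_real (K y)" for y
      using r by (simp add: K_def HL_kernel_of_real del: of_real_exp of_real_divide)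
    have pos: "0 < 1 * K y" for y
    proof -
      have "1 < exp (exp y)" by simp
      then have "0 < exp (exp y) - r" using r by linarith
      then show ?thesis unfolding K_def by (intro mult_pos_pos divide_pos_pos) auto
    qed
    obtain k where k: "f_HL \<sigma> a z 0 = complex_of_real k"
      "real_distribution (density lborel (\<lambda>y. ennreal (exp (y * \<sigma>) * K y / k)))"
      "char (density lborel (\<lambda>y. ennreal (exp (y * \<sigma>) * K y / k))) = F_HL \<sigma> a z"
      by (rule F_HL_eq_char_density[OF a \<open>norm z \<le> 1\<close> \<sigma> z1 kernel pos]) (assumption, rule that, assumption+)
    have "P_HL \<sigma> a z y = complex_of_real (exp (y * \<sigma>) * K y / k)" for y
      unfolding P_HL_def k(1) K_def by (simp add: r(1))
    then show ?thesis
      using k(2,3) by simp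
  qed
  show ?thesis
  proof (intro conjI allI impI iffI, goal_cases)
    case 1
    then show ?case by (rule half)
  next
    case (2 \<sigma>)
    then show ?case using density1 by blast
  next
    \<comment> \<open>The density measure already has this characteristic function, so Levy's
      uniqueness theorem identifies every \<open>M\<close> with it.\<close>
    case (3 \<sigma> M)
    then show ?case using density1 Levy_uniqueness by metis
  next
    case (4 z)
    \<comment> \<open>A single value of \<open>\<sigma>\<close>, here 1, already forces
      \<open>z\<close> to be real.\<close>
    then obtain M where "real_distribution M" "char M = F_HL 1 a z"
      using zero_less_one by blast
    then show ?case
      using char_F_HL_imp_real[OF a, of z 1 M] in_real_segment_iff[of z] 4 by auto
  next
    case (5 z \<sigma>)
    then show ?case using density2 by blast
  next
    case (6 z \<sigma> M)
    then show ?case using density2 Levy_uniqueness by metis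
  qed
qed

end
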